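(* Let $J\in\{I,J_1,J_+\}$, $\otimes\in\{\times,\boxdot\}$, let $G$ be an abelian group and let $f,g:X\to Y$ be continuous maps of closure spaces. If $f\sim_{(J,\otimes)}g$ then $f^*=g^*:H_{(J,\otimes)}^\bullet(Y;G)\to H_{(J,\otimes)}^\bullet(X;G)$. If $f\sim_{(J,\times)}g$ then $f^*=g^*:H_J^\bullet(Y;G)\to H_J^\bullet(X;G)$.
   Context: A closure space $(X,c)$ is a set $X$ with a map $c:\mathcal P(X)\to\mathcal P(X)$ such that $c(\emptyset)=\emptyset$, $A\subseteq c(A)$, and $c(A\cup B)=c(A)\cup c(B)$. The interior is $i(A)=X\setminus c(X\setminus A)$, and $V$ is a neighborhood of $x$ if $x\in i(V)$. A map $f:(X,c)\to(Y,d)$ is continuous if $f(c(A))\subseteq d(f(A))$ for all $A\subseteq X$. Topological spaces are closure spaces via the topological closure. The product $X\times Y$ is the set product with the closure for which the sets $U\times V$ ($U$ a neighborhood of $x$, $V$ of $y$) form a neighborhood base at $(x,y)$; the inductive product $X\boxdot Y$ is the set product with the closure for which the sets $(\{x\}\times V)\cup(U\times\{y\})$ form a neighborhood base at $(x,y)$. Spaces: $I=[0,1]$ with the usual topology; $J_1=\{0,1\}$ with the indiscrete closure; $J_+=\{0,1\}$ with $c(\{0\})=\{0,1\}$, $c(\{1\})=\{1\}$. Singular simplices: $|\Delta^n|^{I}$ is the standard topological $n$-simplex; $|\Delta^n|^{J_1}$ is $\{0,\dots,n\}$ with the indiscrete closure; $|\Delta^n|^{J_+}$ is $\{0,\dots,n\}$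 with $c(\{i\})=\{j: j\ge i\}$. $C^J_n(X)$ is the free abelian group on continuous maps $\sigma:|\Delta^n|^J\to X$, with $\partial\sigma=\sum_{i=0}^n(-1)^i\sigma\circ d^i$, $d^i$ the $i$-th face inclusion. Singular cubes: $J^{\otimes n}$ is the $n$-fold $\otimes$-product (a point if $n=0$). Let $Q_n(X)$ be the free abelian group on continuous maps $\sigma:J^{\otimes n}\to X$ and $D_n(X)$ the subgroup generated by the degenerate $\sigma$, i.e. those that do not depend on their $i$-th coordinate for some $1\le i\le n$. Then $C^{(J,\otimes)}_n(X)=Q_n(X)/D_n(X)$, with $\partial\sigma=\sum_{i=1}^n(-1)^i(A_i\sigma-B_i\sigma)$, where $A_i\sigma$ (resp. $B_i\sigma$) is $\sigma$ with $0$ (resp. $1$) inserted in the $i$-th coordinate. $H_J^n(X;G)$ and $H_{(J,\otimes)}^n(X;G)$ are the cohomology groups of $\operatorname{Hom}_{\mathbb Z}(C^J_\bullet(X),G)$ and $\operatorname{Hom}_{\mathbb Z}(C^{(J,\otimes)}_\bullet(X),G)$; $f^*$ is induced by the chain map $\sigma\mapsto f\circ\sigma$. Homotopy: $f,g:X\to Y$ are one-step $(J,\otimes)$-homotopic if there is a continuous $H:X\otimes J\to Y$ with $H(x,0)=f(x)$ and $H(x,1)=g(x)$; $\sim_{(J,\otimes)}$ is the generated equivalence relation on continuous maps $X\to Y$. *)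

theory Defs
  imports "HOL-Homology.Simplices" "HOL-Algebra.Free_Abelian_Groups"
begin

section \<open>Closure spaces\<close>

record 'a cspace =
  pts :: "'a set"
  cl :: "'a set \<Rightarrow> 'a set"

text \<open>The value of \<open>cl X\<close> on sets that are not contained in \<open>pts X\<close> is irrelevant throughout.\<close>

definition closure_space :: "'a cspace \<Rightarrow> bool" where
  "closure_space X \<longleftrightarrow>
     (\<forall>A. A \<subseteq> pts X \<longrightarrow> cl X A \<subseteq> pts X) \<and>
     cl X {} = {} \<and>
     (\<forall>A. A \<subseteq> pts X \<longrightarrow> A \<subseteq> cl X A) \<and>
     (\<forall>A B. A \<subseteq> pts X \<longrightarrow> B \<subseteq> pts X \<longrightarrow> cl X (A \<union> B) = cl X A \<union> cl X B)"

definition cint :: "'a cspace \<Rightarrow> 'a set \<Rightarrow> 'a set" where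
  "cint X A = pts X - cl X (pts X - A)"

definition nbhd :: "'a cspace \<Rightarrow> 'a \<Rightarrow> 'a set \<Rightarrow> bool" where
  "nbhd X x V \<longleftrightarrow> V \<subseteq> pts X \<and> x \<in> cint X V"

definition cmap :: "'a cspace \<Rightarrow> 'b cspace \<Rightarrow> ('a \<Rightarrow> 'b) \<Rightarrow> bool" where
  "cmap X Y f \<longleftrightarrow>
     f \<in> pts X \<rightarrow> pts Y \<and> (\<forall>A. A \<subseteq> pts X \<longrightarrow> f ` cl X A \<subseteq> cl Y (f ` A))"

definition of_topology :: "'a topology \<Rightarrow> 'a cspace" where
  "of_topology T = \<lparr>pts = topspace T, cl = (\<lambda>A. T closure_of A)\<rparr>"

definition indiscrete_space :: "'a set \<Rightarrow> 'a cspace" where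
  "indiscrete_space S = \<lparr>pts = S, cl = (\<lambda>A. if A = {} then {} else S)\<rparr>"

text \<open>On a finite linearly ordered set this is the closure with \<open>c({i}) = {j. j \<ge> i}\<close>.\<close>

definition upward_space :: "'a::order set \<Rightarrow> 'a cspace" where
  "upward_space S = \<lparr>pts = S, cl = (\<lambda>A. {j \<in> S. \<exists>i\<in>A. i \<le> j})\<rparr>"

text \<open>A point lies in the closure of \<open>A\<close> iff all members of a neighborhood base at the point
  meet \<open>A\<close>, so a closure is determined by neighborhood bases \<open>\<B> p\<close>. The lemmas
  \<open>nbhd_prod_space\<close> and \<open>nbhd_box_space\<close> below confirm that the two products have the
  intended bases.\<close>

definition space_of_bases :: "'a set \<Rightarrow> ('a \<Rightarrow> 'a set set) \<Rightarrow> 'a cspace" where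
  "space_of_bases P \<B> = \<lparr>pts = P, cl = (\<lambda>A. {p \<in> P. \<forall>N \<in> \<B> p. N \<inter> A \<noteq> {}})\<rparr>"

definition prod_space :: "'a cspace \<Rightarrow> 'b cspace \<Rightarrow> ('a \<times> 'b) cspace" where
  "prod_space X Y = space_of_bases (pts X \<times> pts Y)
     (\<lambda>(x, y). {U \<times> V |U V. nbhd X x U \<and> nbhd Y y V})"

definition box_space :: "'a cspace \<Rightarrow> 'b cspace \<Rightarrow> ('a \<times> 'b) cspace" where
  "box_space X Y = space_of_bases (pts X \<times> pts Y)
     (\<lambda>(x, y). {({x} \<times> V) \<union> (U \<times> {y}) |U V. nbhd X x U \<and> nbhd Y y V})"

datatype product_kind = Product | Inductive_Product

fun tensor :: "product_kind \<Rightarrow> 'a cspace \<Rightarrow> 'b cspace \<Rightarrow> ('a \<times> 'b) cspace" where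
  "tensor Product X Y = prod_space X Y"
| "tensor Inductive_Product X Y = box_space X Y"

text \<open>The space obtained by transporting the closure of \<open>X\<close> along a map injective on \<open>pts X\<close>.\<close>

definition transport :: "('a \<Rightarrow> 'b) \<Rightarrow> 'a cspace \<Rightarrow> 'b cspace" where
  "transport h X = \<lparr>pts = h ` pts X, cl = (\<lambda>A. h ` cl X {p \<in> pts X. h p \<in> A})\<rparr>"

text \<open>The three intervals, all realised with points in \<open>real\<close>.\<close>

datatype interval_kind = Interval_I | Interval_J1 | Interval_Jplus

fun interval :: "interval_kind \<Rightarrow> real cspace" where
  "interval Interval_I = of_topology (top_of_set {0..1})"
| "interval Interval_J1 = indiscrete_space {0, 1}"
| "interval Interval_Jplus = upward_space {0, 1}"

section \<open>Homotopy\<close>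

definition one_step_homotopic ::
  "interval_kind \<Rightarrow> product_kind \<Rightarrow> 'a cspace \<Rightarrow> 'b cspace \<Rightarrow> ('a \<Rightarrow> 'b) \<Rightarrow> ('a \<Rightarrow> 'b) \<Rightarrow> bool" where
  "one_step_homotopic J T X Y f g \<longleftrightarrow> cmap X Y f \<and> cmap X Y g \<and>
     (\<exists>H. cmap (tensor T X (interval J)) Y H \<and>
          (\<forall>x \<in> pts X. H (x, 0) = f x \<and> H (x, 1) = g x))"

definition homotopic_JT ::
  "interval_kind \<Rightarrow> product_kind \<Rightarrow> 'a cspace \<Rightarrow> 'b cspace \<Rightarrow> ('a \<Rightarrow> 'b) \<Rightarrow> ('a \<Rightarrow> 'b) \<Rightarrow> bool" where
  "homotopic_JT J T X Y = equivclp (one_step_homotopic J T X Y)"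

section \<open>Cohomology of a chain complex\<close>

text \<open>The homomorphism \<open>K \<mapsto> h(K) M\<close> between quotient groups induced by a homomorphism \<open>h\<close> into
  \<open>H\<close>, where \<open>M\<close> is the subgroup of \<open>H\<close> by which one divides (see \<open>quot_map_coset\<close> below).\<close>

definition quot_map :: "('h, 'm) monoid_scheme \<Rightarrow> 'h set \<Rightarrow> ('g \<Rightarrow> 'h) \<Rightarrow> 'g set \<Rightarrow> 'h set" where
  "quot_map H M h K = (\<Union>x\<in>K. M #>\<^bsub>H\<^esub> h x)"

text \<open>\<open>bdry C n\<close> is the boundary from degree \<open>n\<close> to degree \<open>n - 1\<close>; it is
  only used for \<open>n > 0\<close>.\<close>

record 'c chain_complex =
  chains :: "nat \<Rightarrow> 'c monoid"
  bdry :: "nat \<Rightarrow> 'c \<Rightarrow> 'c"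

definition Hom_group ::
  "('c, 'k) monoid_scheme \<Rightarrow> ('g, 'm) monoid_scheme \<Rightarrow> ('c \<Rightarrow> 'g) monoid" where
  "Hom_group A G =
     \<lparr>carrier = hom A G \<inter> extensional (carrier A),
      monoid.mult = (\<lambda>\<phi> \<psi>. \<lambda>c\<in>carrier A. \<phi> c \<otimes>\<^bsub>G\<^esub> \<psi> c),
      one = (\<lambda>c\<in>carrier A. \<one>\<^bsub>G\<^esub>)\<rparr>"

definition cobdry :: "'c chain_complex \<Rightarrow> nat \<Rightarrow> ('c \<Rightarrow> 'g) \<Rightarrow> 'c \<Rightarrow> 'g" where
  "cobdry C n \<phi> = (\<lambda>c\<in>carrier (chains C (Suc n)). \<phi> (bdry C (Suc n) c))"

definition cocycles :: "'c chain_complex \<Rightarrow> ('g, 'm) monoid_scheme \<Rightarrow> nat \<Rightarrow> ('c \<Rightarrow> 'g) set" where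
  "cocycles C G n = {\<phi> \<in> carrier (Hom_group (chains C n) G).
     cobdry C n \<phi> = \<one>\<^bsub>Hom_group (chains C (Suc n)) G\<^esub>}"

fun coboundaries :: "'c chain_complex \<Rightarrow> ('g, 'm) monoid_scheme \<Rightarrow> nat \<Rightarrow> ('c \<Rightarrow> 'g) set" where
  "coboundaries C G 0 = {\<one>\<^bsub>Hom_group (chains C 0) G\<^esub>}"
| "coboundaries C G (Suc n) = cobdry C n ` carrier (Hom_group (chains C n) G)"

definition cocycle_group ::
  "'c chain_complex \<Rightarrow> ('g, 'm) monoid_scheme \<Rightarrow> nat \<Rightarrow> ('c \<Rightarrow> 'g) monoid" where
  "cocycle_group C G n = (Hom_group (chains C n) G)\<lparr>carrier := cocycles C G n\<rparr>"

definition cohomology_group ::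
  "'c chain_complex \<Rightarrow> ('g, 'm) monoid_scheme \<Rightarrow> nat \<Rightarrow> ('c \<Rightarrow> 'g) set monoid" where
  "cohomology_group C G n = cocycle_group C G n Mod coboundaries C G n"

text \<open>The map \<open>H\<^sup>n(Hom(D,G)) \<rightarrow> H\<^sup>n(Hom(C,G))\<close> induced by a chain map \<open>F : C \<rightarrow> D\<close>.\<close>

definition cohomology_map ::
  "'c chain_complex \<Rightarrow> 'd chain_complex \<Rightarrow> (nat \<Rightarrow> 'c \<Rightarrow> 'd) \<Rightarrow> ('g, 'm) monoid_scheme \<Rightarrow> nat \<Rightarrow>
   ('d \<Rightarrow> 'g) set \<Rightarrow> ('c \<Rightarrow> 'g) set" where
  "cohomology_map C D F G n =
     (\<lambda>K\<in>carrier (cohomology_group D G n).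
        quot_map (cocycle_group C G n) (coboundaries C G n)
          (\<lambda>\<phi>. \<lambda>c\<in>carrier (chains C n). \<phi> (F n c)) K)"

section \<open>Singular simplices and singular cubes\<close>

text \<open>As in \<^theory>\<open>HOL-Homology.Simplices\<close>, singular simplices and cubes are normalised to be
  \<^const>\<open>undefined\<close> outside the points of their domain, so that distinct functions are
  distinct maps.\<close>

definition cmaps :: "'d cspace \<Rightarrow> 'a cspace \<Rightarrow> ('d \<Rightarrow> 'a) set" where
  "cmaps P X = {\<sigma> \<in> extensional (pts P). cmap P X \<sigma>}"

definition push_forward ::
  "'d cspace \<Rightarrow> ('a \<Rightarrow> 'b) \<Rightarrow> (('d \<Rightarrow> 'a) \<Rightarrow>\<^sub>0 int) \<Rightarrow> (('d \<Rightarrow> 'b) \<Rightarrow>\<^sub>0 int)" where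
  "push_forward P f = frag_extend (\<lambda>\<sigma>. frag_of (restrict (f \<circ> \<sigma>) (pts P)))"

text \<open>\<open>\<Delta> n\<close> is the model \<open>n\<close>-simplex and \<open>d i\<close> the \<open>i\<close>-th face inclusion \<open>\<Delta> (n - 1) \<rightarrow> \<Delta> n\<close>.\<close>

definition simplicial_boundary ::
  "(nat \<Rightarrow> 'd cspace) \<Rightarrow> (nat \<Rightarrow> 'd \<Rightarrow> 'd) \<Rightarrow> nat \<Rightarrow> (('d \<Rightarrow> 'a) \<Rightarrow>\<^sub>0 int) \<Rightarrow> (('d \<Rightarrow> 'a) \<Rightarrow>\<^sub>0 int)" where
  "simplicial_boundary \<Delta> d n = (if n = 0 then (\<lambda>_. 0) else
     frag_extend (\<lambda>\<sigma>. \<Sum>i\<le>n. frag_cmul ((-1) ^ i)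
       (frag_of (restrict (\<sigma> \<circ> d i) (pts (\<Delta> (n - 1)))))))"

definition simplicial_complex ::
  "(nat \<Rightarrow> 'd cspace) \<Rightarrow> (nat \<Rightarrow> 'd \<Rightarrow> 'd) \<Rightarrow> 'a cspace \<Rightarrow> (('d \<Rightarrow> 'a) \<Rightarrow>\<^sub>0 int) chain_complex" where
  "simplicial_complex \<Delta> d X =
     \<lparr>chains = (\<lambda>n. free_Abelian_group (cmaps (\<Delta> n) X)),
      bdry = simplicial_boundary \<Delta> d\<rparr>"

definition simplicial_pullback ::
  "(nat \<Rightarrow> 'd cspace) \<Rightarrow> (nat \<Rightarrow> 'd \<Rightarrow> 'd) \<Rightarrow> 'a cspace \<Rightarrow> 'b cspace \<Rightarrow> ('g, 'm) monoid_scheme \<Rightarrow>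
   nat \<Rightarrow> ('a \<Rightarrow> 'b) \<Rightarrow> ((('d \<Rightarrow> 'b) \<Rightarrow>\<^sub>0 int) \<Rightarrow> 'g) set \<Rightarrow> ((('d \<Rightarrow> 'a) \<Rightarrow>\<^sub>0 int) \<Rightarrow> 'g) set" where
  "simplicial_pullback \<Delta> d X Y G n f =
     cohomology_map (simplicial_complex \<Delta> d X) (simplicial_complex \<Delta> d Y)
       (\<lambda>m. push_forward (\<Delta> m) f) G n"

definition simplex_I :: "nat \<Rightarrow> (nat \<Rightarrow> real) cspace" where
  "simplex_I n = of_topology (subtopology (powertop_real UNIV) (standard_simplex n))"

definition simplex_J1 :: "nat \<Rightarrow> nat cspace" where
  "simplex_J1 n = indiscrete_space {0..n}"

definition simplex_Jplus :: "nat \<Rightarrow> nat cspace" where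
  "simplex_Jplus n = upward_space {0..n}"

text \<open>The face inclusions of \<open>simplex_I\<close> are \<open>simplical_face i\<close> from
  \<^theory>\<open>HOL-Homology.Simplices\<close>; the following are those of \<open>simplex_J1\<close> and \<open>simplex_Jplus\<close>.\<close>

definition vertex_face :: "nat \<Rightarrow> nat \<Rightarrow> nat" where
  "vertex_face i j = (if j < i then j else Suc j)"

text \<open>Points of the \<open>n\<close>-cube are lists of length \<open>n\<close>.\<close>

fun cube :: "interval_kind \<Rightarrow> product_kind \<Rightarrow> nat \<Rightarrow> real list cspace" where
  "cube J T 0 = indiscrete_space {[]}"
| "cube J T (Suc n) = transport (\<lambda>(xs, t). xs @ [t]) (tensor T (cube J T n) (interval J))"

text \<open>Coordinates are numbered from \<open>1\<close>.\<close>

definition insert_coord :: "nat \<Rightarrow> real \<Rightarrow> real list \<Rightarrow> real list" where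
  "insert_coord i t xs = take (i - 1) xs @ t # drop (i - 1) xs"

definition degenerate_cubes ::
  "interval_kind \<Rightarrow> product_kind \<Rightarrow> nat \<Rightarrow> 'a cspace \<Rightarrow> (real list \<Rightarrow> 'a) set" where
  "degenerate_cubes J T n X = {\<sigma> \<in> cmaps (cube J T n) X. \<exists>i\<in>{1..n}.
     \<forall>xs \<in> pts (cube J T n). \<forall>ys \<in> pts (cube J T n).
       (\<forall>j\<in>{1..n}. j \<noteq> i \<longrightarrow> xs ! (j - 1) = ys ! (j - 1)) \<longrightarrow> \<sigma> xs = \<sigma> ys}"

definition cube_chains ::
  "interval_kind \<Rightarrow> product_kind \<Rightarrow> 'a cspace \<Rightarrow> nat \<Rightarrow> ((real list \<Rightarrow> 'a) \<Rightarrow>\<^sub>0 int) monoid" where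
  "cube_chains J T X n = free_Abelian_group (cmaps (cube J T n) X)"

definition degenerate_chains ::
  "interval_kind \<Rightarrow> product_kind \<Rightarrow> 'a cspace \<Rightarrow> nat \<Rightarrow> ((real list \<Rightarrow> 'a) \<Rightarrow>\<^sub>0 int) set" where
  "degenerate_chains J T X n = generate (cube_chains J T X n) (frag_of ` degenerate_cubes J T n X)"

definition cube_boundary ::
  "interval_kind \<Rightarrow> product_kind \<Rightarrow> nat \<Rightarrow>
   ((real list \<Rightarrow> 'a) \<Rightarrow>\<^sub>0 int) \<Rightarrow> ((real list \<Rightarrow> 'a) \<Rightarrow>\<^sub>0 int)" where
  "cube_boundary J T n = frag_extend (\<lambda>\<sigma>. \<Sum>i\<in>{1..n}. frag_cmul ((-1) ^ i)
     (frag_of (restrict (\<sigma> \<circ> insert_coord i 0) (pts (cube J T (n - 1)))) -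
      frag_of (restrict (\<sigma> \<circ> insert_coord i 1) (pts (cube J T (n - 1))))))"

definition cubical_complex ::
  "interval_kind \<Rightarrow> product_kind \<Rightarrow> 'a cspace \<Rightarrow> ((real list \<Rightarrow> 'a) \<Rightarrow>\<^sub>0 int) set chain_complex" where
  "cubical_complex J T X =
     \<lparr>chains = (\<lambda>n. cube_chains J T X n Mod degenerate_chains J T X n),
      bdry = (\<lambda>n. quot_map (cube_chains J T X (n - 1)) (degenerate_chains J T X (n - 1))
                    (cube_boundary J T n))\<rparr>"

definition cubical_pullback ::
  "interval_kind \<Rightarrow> product_kind \<Rightarrow> 'a cspace \<Rightarrow> 'b cspace \<Rightarrow> ('g, 'm) monoid_scheme \<Rightarrow>
   nat \<Rightarrow> ('a \<Rightarrow> 'b) \<Rightarrow>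
   (((real list \<Rightarrow> 'b) \<Rightarrow>\<^sub>0 int) set \<Rightarrow> 'g) set \<Rightarrow> (((real list \<Rightarrow> 'a) \<Rightarrow>\<^sub>0 int) set \<Rightarrow> 'g) set" where
  "cubical_pullback J T X Y G n f =
     cohomology_map (cubical_complex J T X) (cubical_complex J T Y)
       (\<lambda>m. quot_map (cube_chains J T Y m) (degenerate_chains J T Y m)
              (push_forward (cube J T m) f)) G n"

section \<open>Consistency of the definitions\<close>

lemma cl_mono:
  assumes "closure_space X" "A \<subseteq> B" "B \<subseteq> pts X"
  shows "cl X A \<subseteq> cl X B"
proof -
  have "cl X (A \<union> B) = cl X A \<union> cl X B"
    using assms unfolding closure_space_def by (meson order_trans)
  moreover have "A \<union> B = B"
    using assms by blast
  ultimately show ?thesis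
    by auto
qed

lemma nbhd_pts: "closure_space X \<Longrightarrow> x \<in> pts X \<Longrightarrow> nbhd X x (pts X)"
  by (simp add: nbhd_def cint_def closure_space_def)

lemma nbhd_in_pts: "nbhd X x U \<Longrightarrow> x \<in> pts X"
  by (simp add: nbhd_def cint_def)

lemma nbhd_mem:
  assumes "closure_space X" "nbhd X x V"
  shows "x \<in> V"
proof -
  have "pts X - V \<subseteq> cl X (pts X - V)"
    using assms by (simp add: closure_space_def)
  then show ?thesis
    using assms by (auto simp: nbhd_def cint_def)
qed

lemma nbhd_Int:
  assumes "closure_space X" "nbhd X x U" "nbhd X x V"
  shows "nbhd X x (U \<inter> V)"
proof -
  have "cl X (pts X - U \<inter> V) = cl X (pts X - U) \<union> cl X (pts X - V)"
    using assms(1) by (simp add: closure_space_def Diff_Int)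
  then show ?thesis
    using assms by (auto simp: nbhd_def cint_def)
qed

text \<open>A family of filter bases makes \<open>space_of_bases\<close> a closure space having it as
  neighborhood bases.\<close>

lemma space_of_bases:
  assumes ne: "\<And>p. p \<in> P \<Longrightarrow> \<B> p \<noteq> {}"
    and mem: "\<And>p N. p \<in> P \<Longrightarrow> N \<in> \<B> p \<Longrightarrow> p \<in> N \<and> N \<subseteq> P"
    and int: "\<And>p N M. p \<in> P \<Longrightarrow> N \<in> \<B> p \<Longrightarrow> M \<in> \<B> p \<Longrightarrow> \<exists>L \<in> \<B> p. L \<subseteq> N \<inter> M"
  shows closure_space_of_bases: "closure_space (space_of_bases P \<B>)"
    and nbhd_space_of_bases:
      "nbhd (space_of_bases P \<B>) p W \<longleftrightarrow> p \<in> P \<and> W \<subseteq> P \<and> (\<exists>N \<in> \<B> p. N \<subseteq> W)"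
proof -
  have "(\<forall>N\<in>\<B> q. N \<inter> A \<noteq> {}) \<or> (\<forall>N\<in>\<B> q. N \<inter> B \<noteq> {})"
    if "q \<in> P" and *: "\<forall>N\<in>\<B> q. N \<inter> (A \<union> B) \<noteq> {}" for q A B
  proof (rule ccontr)
    assume "\<not> ?thesis"
    then obtain N M where NM: "N \<in> \<B> q" "N \<inter> A = {}" "M \<in> \<B> q" "M \<inter> B = {}"
      by blast
    then obtain L where L: "L \<in> \<B> q" "L \<subseteq> N \<inter> M"
      using int[OF \<open>q \<in> P\<close> NM(1) NM(3)] by (elim bexE)
    then have "L \<inter> (A \<union> B) = {}"
      using NM(2) NM(4) by blast
    then show False
      using * L(1) by simp
  qed
  then have "cl (space_of_bases P \<B>) (A \<union> B) \<subseteq>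
      cl (space_of_bases P \<B>) A \<union> cl (space_of_bases P \<B>) B" for A B
    unfolding space_of_bases_def by auto
  moreover have "cl (space_of_bases P \<B>) A \<union> cl (space_of_bases P \<B>) B \<subseteq>
      cl (space_of_bases P \<B>) (A \<union> B)" for A B
    unfolding space_of_bases_def by auto
  ultimately have "cl (space_of_bases P \<B>) (A \<union> B) =
      cl (space_of_bases P \<B>) A \<union> cl (space_of_bases P \<B>) B" for A B
    by (rule equalityI)
  moreover have "cl (space_of_bases P \<B>) {} = {}"
    using ne by (auto simp: space_of_bases_def)
  moreover have "A \<subseteq> cl (space_of_bases P \<B>) A" if "A \<subseteq> P" for A
  proof
    fix p assume "p \<in> A"
    then have "p \<in> P" using that by auto
    then show "p \<in> cl (space_of_bases P \<B>) A"
      using mem[OF \<open>p \<in> P\<close>] \<open>p \<in> A\<close> unfolding space_of_bases_def by auto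
  qed
  moreover have "cl (space_of_bases P \<B>) A \<subseteq> P" "pts (space_of_bases P \<B>) = P" for A
    by (auto simp: space_of_bases_def)
  ultimately show "closure_space (space_of_bases P \<B>)"
    unfolding closure_space_def by simp
  have "N \<inter> (P - W) = {} \<longleftrightarrow> N \<subseteq> W" if "p \<in> P" "N \<in> \<B> p" for N
    using mem[OF that] by blast
  then have "(\<exists>N \<in> \<B> p. N \<inter> (P - W) = {}) \<longleftrightarrow> (\<exists>N \<in> \<B> p. N \<subseteq> W)" if "p \<in> P"
    using that by (intro bex_cong refl) simp
  then show "nbhd (space_of_bases P \<B>) p W \<longleftrightarrow> p \<in> P \<and> W \<subseteq> P \<and> (\<exists>N \<in> \<B> p. N \<subseteq> W)"
    by (auto simp: nbhd_def cint_def space_of_bases_def)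
qed

lemma
  assumes X: "closure_space X" and Y: "closure_space Y"
  shows closure_space_prod_space: "closure_space (prod_space X Y)"
    and nbhd_prod_space: "nbhd (prod_space X Y) (x, y) W \<longleftrightarrow> W \<subseteq> pts X \<times> pts Y \<and>
      (\<exists>U V. nbhd X x U \<and> nbhd Y y V \<and> U \<times> V \<subseteq> W)"
proof -
  let ?\<B> = "\<lambda>(x, y). {U \<times> V |U V. nbhd X x U \<and> nbhd Y y V}"
  have ne: "?\<B> p \<noteq> {}" if "p \<in> pts X \<times> pts Y" for p
  proof -
    have "nbhd X (fst p) (pts X)" "nbhd Y (snd p) (pts Y)"
      using that nbhd_pts[OF X] nbhd_pts[OF Y] by auto
    then show ?thesis
      by (auto simp: split_def)
  qed
  have mem: "p \<in> N \<and> N \<subseteq> pts X \<times> pts Y" if "p \<in> pts X \<times> pts Y" "N \<in> ?\<B> p" for p N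
    using that nbhd_mem[OF X] nbhd_mem[OF Y] by (auto simp: nbhd_def)
  have int: "\<exists>L \<in> ?\<B> p. L \<subseteq> N \<inter> M"
    if p: "p \<in> pts X \<times> pts Y" "N \<in> ?\<B> p" "M \<in> ?\<B> p" for p N M
  proof -
    obtain x y where [simp]: "p = (x, y)"
      by (cases p)
    obtain U V where 1: "N = U \<times> V" "nbhd X x U" "nbhd Y y V"
      using p(2) by auto
    obtain U' V' where 2: "M = U' \<times> V'" "nbhd X x U'" "nbhd Y y V'"
      using p(3) by auto
    have "nbhd X x (U \<inter> U')" "nbhd Y y (V \<inter> V')"
      using 1 2 nbhd_Int[OF X] nbhd_Int[OF Y] by auto
    then have "(U \<inter> U') \<times> (V \<inter> V') \<in> ?\<B> p"
      by auto
    then show ?thesis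
      using 1 2 by (intro bexI) auto
  qed
  show "closure_space (prod_space X Y)"
    unfolding prod_space_def by (rule closure_space_of_bases[OF ne mem int])
  have ex: "(\<exists>N \<in> ?\<B> (x, y). N \<subseteq> W) \<longleftrightarrow>
      (\<exists>U V. nbhd X x U \<and> nbhd Y y V \<and> U \<times> V \<subseteq> W)"
    unfolding prod.case by blast
  have "nbhd (prod_space X Y) (x, y) W \<longleftrightarrow>
      (x, y) \<in> pts X \<times> pts Y \<and> W \<subseteq> pts X \<times> pts Y \<and> (\<exists>N \<in> ?\<B> (x, y). N \<subseteq> W)"
    unfolding prod_space_def by (rule nbhd_space_of_bases[OF ne mem int])
  then show "nbhd (prod_space X Y) (x, y) W \<longleftrightarrow> W \<subseteq> pts X \<times> pts Y \<and>
      (\<exists>U V. nbhd X x U \<and> nbhd Y y V \<and> U \<times> V \<subseteq> W)"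
    unfolding ex using nbhd_in_pts[of X x] nbhd_in_pts[of Y y] by blast
qed

lemma
  assumes X: "closure_space X" and Y: "closure_space Y"
  shows closure_space_box_space: "closure_space (box_space X Y)"
    and nbhd_box_space: "nbhd (box_space X Y) (x, y) W \<longleftrightarrow> W \<subseteq> pts X \<times> pts Y \<and>
      (\<exists>U V. nbhd X x U \<and> nbhd Y y V \<and> ({x} \<times> V) \<union> (U \<times> {y}) \<subseteq> W)"
proof -
  let ?\<B> = "\<lambda>(x, y). {({x} \<times> V) \<union> (U \<times> {y}) |U V. nbhd X x U \<and> nbhd Y y V}"
  have ne: "?\<B> p \<noteq> {}" if "p \<in> pts X \<times> pts Y" for p
  proof -
    have "nbhd X (fst p) (pts X)" "nbhd Y (snd p) (pts Y)"
      using that nbhd_pts[OF X] nbhd_pts[OF Y] by auto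
    then show ?thesis
      by (auto simp: split_def)
  qed
  have mem: "p \<in> N \<and> N \<subseteq> pts X \<times> pts Y" if "p \<in> pts X \<times> pts Y" "N \<in> ?\<B> p" for p N
    using that nbhd_mem[OF X] nbhd_mem[OF Y] by (auto simp: nbhd_def)
  have int: "\<exists>L \<in> ?\<B> p. L \<subseteq> N \<inter> M"
    if p: "p \<in> pts X \<times> pts Y" "N \<in> ?\<B> p" "M \<in> ?\<B> p" for p N M
  proof -
    obtain x y where [simp]: "p = (x, y)"
      by (cases p)
    obtain U V where 1: "N = ({x} \<times> V) \<union> (U \<times> {y})" "nbhd X x U" "nbhd Y y V"
      using p(2) by auto
    obtain U' V' where 2: "M = ({x} \<times> V') \<union> (U' \<times> {y})" "nbhd X x U'" "nbhd Y y V'"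
      using p(3) by auto
    have "nbhd X x (U \<inter> U')" "nbhd Y y (V \<inter> V')"
      using 1 2 nbhd_Int[OF X] nbhd_Int[OF Y] by auto
    then have "({x} \<times> (V \<inter> V')) \<union> ((U \<inter> U') \<times> {y}) \<in> ?\<B> p"
      by auto
    then show ?thesis
      using 1 2 by (intro bexI) auto
  qed
  show "closure_space (box_space X Y)"
    unfolding box_space_def by (rule closure_space_of_bases[OF ne mem int])
  have ex: "(\<exists>N \<in> ?\<B> (x, y). N \<subseteq> W) \<longleftrightarrow>
      (\<exists>U V. nbhd X x U \<and> nbhd Y y V \<and> ({x} \<times> V) \<union> (U \<times> {y}) \<subseteq> W)"
    unfolding prod.case by blast
  have "nbhd (box_space X Y) (x, y) W \<longleftrightarrow>
      (x, y) \<in> pts X \<times> pts Y \<and> W \<subseteq> pts X \<times> pts Y \<and> (\<exists>N \<in> ?\<B> (x, y). N \<subseteq> W)"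
    unfolding box_space_def by (rule nbhd_space_of_bases[OF ne mem int])
  then show "nbhd (box_space X Y) (x, y) W \<longleftrightarrow> W \<subseteq> pts X \<times> pts Y \<and>
      (\<exists>U V. nbhd X x U \<and> nbhd Y y V \<and> ({x} \<times> V) \<union> (U \<times> {y}) \<subseteq> W)"
    unfolding ex using nbhd_in_pts[of X x] nbhd_in_pts[of Y y] by blast
qed

lemma cl_interval_Jplus:
  "cl (interval Interval_Jplus) {0} = {0, 1}" "cl (interval Interval_Jplus) {1} = {1}"
  by (auto simp: upward_space_def)

lemma pts_tensor: "pts (tensor T X Y) = pts X \<times> pts Y"
  by (cases T) (simp_all add: prod_space_def box_space_def space_of_bases_def)

lemma pts_cube: "pts (cube J T n) = {xs. length xs = n \<and> set xs \<subseteq> pts (interval J)}"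
proof (induction n)
  case 0
  then show ?case
    by (auto simp: indiscrete_space_def)
next
  case (Suc n)
  have "xs \<in> (\<lambda>(xs, t). xs @ [t]) ` ({xs. length xs = n \<and> set xs \<subseteq> A} \<times> A)"
    if "length xs = Suc n" "set xs \<subseteq> A" for xs and A :: "real set"
    using that by (cases xs rule: rev_cases) auto
  then show ?case
    using Suc by (auto simp: transport_def pts_tensor)
qed

lemma quot_map_coset:
  assumes G: "group G" and H: "group H" and h: "h \<in> hom G H" and x: "x \<in> carrier G"
    and N: "subgroup N G" and M: "M \<lhd> H" and sub: "h ` N \<subseteq> M"
  shows "quot_map H M h (N #>\<^bsub>G\<^esub> x) = M #>\<^bsub>H\<^esub> h x"
proof -
  interpret H: group H by fact
  interpret M: normal M H by fact
  have eq: "M #>\<^bsub>H\<^esub> h (n \<otimes>\<^bsub>G\<^esub> x) = M #>\<^bsub>H\<^esub> h x" if "n \<in> N" for n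
  proof -
    have n: "n \<in> carrier G" "h n \<in> M"
      using that N sub subgroup.mem_carrier by auto
    have "h (n \<otimes>\<^bsub>G\<^esub> x) = h n \<otimes>\<^bsub>H\<^esub> h x"
      using h n x by (simp add: hom_def)
    moreover have "h x \<in> carrier H" "h n \<in> carrier H"
      using h x n by (auto simp: hom_def)
    ultimately have "M #>\<^bsub>H\<^esub> h (n \<otimes>\<^bsub>G\<^esub> x) = (M #>\<^bsub>H\<^esub> h n) #>\<^bsub>H\<^esub> h x"
      by (simp add: H.coset_mult_assoc M.subset)
    then show ?thesis
      using n(2) by (simp add: H.coset_join2 M.subgroup_axioms M.subset subsetD)
  qed
  have "quot_map H M h (N #>\<^bsub>G\<^esub> x) = (\<Union>n\<in>N. M #>\<^bsub>H\<^esub> h (n \<otimes>\<^bsub>G\<^esub> x))"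
    by (auto simp: quot_map_def r_coset_def)
  also have "\<dots> = M #>\<^bsub>H\<^esub> h x"
    using eq subgroup.one_closed[OF N] by auto
  finally show ?thesis .
qed

end

theory Submission
  imports Defs
begin

text \<open>A homotopy \<open>H\<close> from \<open>f\<close> to \<open>g\<close> yields a chain homotopy between the chain maps induced by \<open>f\<close>
  and \<open>g\<close>, hence equal maps in cohomology. For cubes it sends \<open>\<sigma>\<close> to the cube
  \<open>(z, t) \<mapsto> H (\<sigma> z, t)\<close> of one dimension more; this needs only that \<open>\<sigma> \<otimes> id\<close> is continuous, which
  holds for both products. For simplices it is the alternating sum of the maps
  \<open>x \<mapsto> H (\<sigma> (s\<^sub>i x), t\<^sub>i x)\<close>, where \<open>s\<^sub>i\<close> is a degeneracy map and \<open>t\<^sub>i\<close> sends the vertices up to \<open>i\<close>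
  to 0 and the others to 1; continuity of the pairing requires the product \<open>\<times>\<close>.\<close>

section \<open>Chain homotopies and cohomology\<close>

text \<open>The simplicial argument uses the three kinds of model simplices only through identities
  between faces, degeneracies and steps, so it is done once, in the locale
  \<open>simplicial_model\<close>, and the intervals enter as instances. The two products differ in
  the shape of their neighborhoods: near its center a cross contains only points sharing a
  coordinate with that center, so a pair of continuous maps may leave it at once, whereas a map
  acting on the factors separately, or fixing one of them, sends crosses into crosses. Cubes require
  only maps of the latter kinds, because the homotopy parameter is a new coordinate there. The
  cubical complex is moreover a quotient: boundary, push-forward and prism must each preserve
  degenerate chains before the homotopy identity, proved for chains, can be read for cosets. That
  identity has the form F' = P d + (d P + F), d being the boundary; a cocycle annihilates d P and
  turns P d into a coboundary. Finally, equality of induced maps is itself an equivalence relation,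
  so one-step homotopies suffice.\<close>

lemma comm_group_Hom_group:
  assumes "comm_group G" "group A"
  shows "comm_group (Hom_group A G)"
proof -
  interpret G: comm_group G by fact
  interpret A: group A by fact
  show ?thesis
  proof (rule comm_groupI)
    fix \<phi> assume \<phi>: "\<phi> \<in> carrier (Hom_group A G)"
    let ?\<psi> = "\<lambda>c\<in>carrier A. inv\<^bsub>G\<^esub> \<phi> c"
    have "?\<psi> \<in> carrier (Hom_group A G)"
      using \<phi> by (auto simp: Hom_group_def hom_def Pi_iff G.inv_mult)
    moreover have "?\<psi> \<otimes>\<^bsub>Hom_group A G\<^esub> \<phi> = \<one>\<^bsub>Hom_group A G\<^esub>"
      using \<phi> by (auto simp: Hom_group_def hom_def Pi_iff fun_eq_iff)
    ultimately show "\<exists>\<psi>\<in>carrier (Hom_group A G). \<psi> \<otimes>\<^bsub>Hom_group A G\<^esub> \<phi> = \<one>\<^bsub>Hom_group A G\<^esub>"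
      by blast
  next
    fix \<phi> assume "\<phi> \<in> carrier (Hom_group A G)"
    then show "\<one>\<^bsub>Hom_group A G\<^esub> \<otimes>\<^bsub>Hom_group A G\<^esub> \<phi> = \<phi>"
      by (auto simp: Hom_group_def hom_def Pi_iff fun_eq_iff extensional_def)
  qed (auto simp: Hom_group_def hom_def Pi_iff G.m_ac fun_eq_iff)
qed

text \<open>Serves with \<open>k\<close> a boundary (coboundary operator), a chain map (pullback of
  cochains) and a prism operator (cochain homotopy).\<close>

lemma hom_precompose:
  assumes "group A" "k \<in> hom A B"
  shows "(\<lambda>\<phi>. \<lambda>c\<in>carrier A. \<phi> (k c)) \<in> hom (Hom_group B G) (Hom_group A G)"
  using assms(2) monoid.m_closed[OF group.is_monoid[OF assms(1)]]
  by (auto simp: Hom_group_def hom_def Pi_iff fun_eq_iff)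

lemma subgroup_coboundaries:
  assumes "comm_group G" "\<And>n. group (chains C n)"
    and "\<And>n. bdry C (Suc n) \<in> hom (chains C (Suc n)) (chains C n)"
  shows "subgroup (coboundaries C G n) (Hom_group (chains C n) G)"
proof (cases n)
  case 0
  then show ?thesis
    using group.triv_subgroup[OF comm_group.axioms(2)[OF comm_group_Hom_group[OF assms(1,2)]]] by simp
next
  case (Suc m)
  have "cobdry C m \<in> hom (Hom_group (chains C m) G) (Hom_group (chains C (Suc m)) G)"
    using hom_precompose[OF assms(2,3)] by (simp add: cobdry_def[abs_def])
  then have "group_hom (Hom_group (chains C m) G) (Hom_group (chains C (Suc m)) G) (cobdry C m)"
    by (intro group_hom.intro group_hom_axioms.intro comm_group.axioms(2) comm_group_Hom_group assms)
  then show ?thesis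
    using Suc group_hom.img_is_subgroup by fastforce
qed

text \<open>Pulling back along a chain map sends coboundaries to coboundaries, so the union in
  \<open>quot_map\<close> is a single coset. The computation takes place in the whole
  \<open>Hom_group\<close>; \<open>r_coset\<close> refers only to the multiplication, so cosets in
  the cocycle group are the same sets.\<close>

lemma cohomology_map_coset:
  assumes G: "comm_group G"
    and C: "\<And>n. group (chains C n)" and D: "\<And>n. group (chains D n)"
    and bC: "\<And>n. bdry C (Suc n) \<in> hom (chains C (Suc n)) (chains C n)"
    and bD: "\<And>n. bdry D (Suc n) \<in> hom (chains D (Suc n)) (chains D n)"
    and F: "\<And>n. F n \<in> hom (chains C n) (chains D n)"
    and chain: "\<And>n c. c \<in> carrier (chains C (Suc n)) \<Longrightarrow>
      bdry D (Suc n) (F (Suc n) c) = F n (bdry C (Suc n) c)"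
    and \<phi>: "\<phi> \<in> cocycles D G n"
  shows "cohomology_map C D F G n (coboundaries D G n #>\<^bsub>Hom_group (chains D n) G\<^esub> \<phi>) =
    coboundaries C G n #>\<^bsub>Hom_group (chains C n) G\<^esub> (\<lambda>c\<in>carrier (chains C n). \<phi> (F n c))"
proof -
  let ?h = "\<lambda>n \<phi>. \<lambda>c\<in>carrier (chains C n). \<phi> (F n c)"
  have h: "?h n \<in> hom (Hom_group (chains D n) G) (Hom_group (chains C n) G)" for n
    using C F by (rule hom_precompose)
  have "?h n \<psi> \<in> coboundaries C G n" if \<psi>: "\<psi> \<in> coboundaries D G n" for \<psi>
  proof (cases n)
    case 0
    have "?h 0 \<one>\<^bsub>Hom_group (chains D 0) G\<^esub> = \<one>\<^bsub>Hom_group (chains C 0) G\<^esub>"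
      using F by (intro hom_one[OF h] comm_group.axioms(2) comm_group_Hom_group G C D)
    then show ?thesis
      using \<psi> 0 by simp
  next
    case (Suc m)
    then obtain \<theta> where \<theta>: "\<theta> \<in> carrier (Hom_group (chains D m) G)" "\<psi> = cobdry D m \<theta>"
      using \<psi> by auto
    \<comment> \<open>Since \<open>F\<close> commutes with the boundaries, the pullback of the
      coboundary of \<theta> is the coboundary of the pullback of \<theta>.\<close>
    have "?h (Suc m) \<psi> = cobdry C m (?h m \<theta>)"
      using \<theta>(2) hom_in_carrier[OF bC] hom_in_carrier[OF F] chain
      by (auto simp: cobdry_def fun_eq_iff)
    moreover have "?h m \<theta> \<in> carrier (Hom_group (chains C m) G)"
      using hom_in_carrier[OF h \<theta>(1)] .
    ultimately show ?thesis
      using Suc by simp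
  qed
  moreover have "coboundaries C G n \<lhd> Hom_group (chains C n) G"
    using comm_group_Hom_group[OF G C] subgroup_coboundaries[OF G C bC]
    by (rule comm_group.subgroup_imp_normal)
  moreover have "\<phi> \<in> carrier (Hom_group (chains D n) G)"
    using \<phi> by (simp add: cocycles_def)
  ultimately have "quot_map (Hom_group (chains C n) G) (coboundaries C G n) (?h n)
      (coboundaries D G n #>\<^bsub>Hom_group (chains D n) G\<^esub> \<phi>) =
    coboundaries C G n #>\<^bsub>Hom_group (chains C n) G\<^esub> ?h n \<phi>"
    using subgroup_coboundaries[OF G D bD]
    by (intro quot_map_coset h comm_group.axioms(2) comm_group_Hom_group G C D) auto
  moreover have "coboundaries D G n #>\<^bsub>Hom_group (chains D n) G\<^esub> \<phi>
      \<in> carrier (cohomology_group D G n)"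
    using \<phi> by (auto simp: cohomology_group_def FactGroup_def RCOSETS_def r_coset_def cocycle_group_def)
  ultimately show ?thesis
    by (simp add: cohomology_map_def quot_map_def cocycle_group_def r_coset_def)
qed

text \<open>A cocycle kills boundaries, so evaluating it on the homotopy identity leaves F plus a
  coboundary. Degree 0 is a separate assumption because no boundary leaves it.\<close>

lemma cohomology_map_eq_if_chain_homotopic:
  assumes G: "comm_group G"
    and C: "\<And>n. group (chains C n)" and D: "\<And>n. group (chains D n)"
    and bC: "\<And>n. bdry C (Suc n) \<in> hom (chains C (Suc n)) (chains C n)"
    and bD: "\<And>n. bdry D (Suc n) \<in> hom (chains D (Suc n)) (chains D n)"
    and F: "\<And>n. F n \<in> hom (chains C n) (chains D n)"
    and chain: "\<And>n c. c \<in> carrier (chains C (Suc n)) \<Longrightarrow>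
      bdry D (Suc n) (F (Suc n) c) = F n (bdry C (Suc n) c)"
    and F': "\<And>n. F' n \<in> hom (chains C n) (chains D n)"
    and chain': "\<And>n c. c \<in> carrier (chains C (Suc n)) \<Longrightarrow>
      bdry D (Suc n) (F' (Suc n) c) = F' n (bdry C (Suc n) c)"
    and P: "\<And>n. P n \<in> hom (chains C n) (chains D (Suc n))"
    and htpy_0: "\<And>c. c \<in> carrier (chains C 0) \<Longrightarrow>
      F' 0 c = bdry D (Suc 0) (P 0 c) \<otimes>\<^bsub>chains D 0\<^esub> F 0 c"
    and htpy_Suc: "\<And>n c. c \<in> carrier (chains C (Suc n)) \<Longrightarrow>
      F' (Suc n) c = P n (bdry C (Suc n) c) \<otimes>\<^bsub>chains D (Suc n)\<^esub>
        (bdry D (Suc (Suc n)) (P (Suc n) c) \<otimes>\<^bsub>chains D (Suc n)\<^esub> F (Suc n) c)"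
  shows "cohomology_map C D F G n = cohomology_map C D F' G n"
proof
  interpret G: comm_group G by fact
  fix K
  show "cohomology_map C D F G n K = cohomology_map C D F' G n K"
  proof (cases "K \<in> carrier (cohomology_group D G n)")
    case True
    then obtain \<phi> where \<phi>: "\<phi> \<in> cocycles D G n"
      and K: "K = coboundaries D G n #>\<^bsub>Hom_group (chains D n) G\<^esub> \<phi>"
      by (auto simp: cohomology_group_def FactGroup_def RCOSETS_def r_coset_def cocycle_group_def)
    let ?H = "Hom_group (chains C n) G"
    let ?h = "\<lambda>c\<in>carrier (chains C n). \<phi> (F n c)"
    let ?h' = "\<lambda>c\<in>carrier (chains C n). \<phi> (F' n c)"
    interpret H: comm_group ?H
      using G C by (rule comm_group_Hom_group)
    interpret B: subgroup "coboundaries C G n" ?H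
      using G C bC by (rule subgroup_coboundaries)
    have \<phi>_hom: "\<phi> \<in> hom (chains D n) G" and \<phi>_carrier: "\<phi> \<in> carrier (Hom_group (chains D n) G)"
      using \<phi> by (auto simp: cocycles_def Hom_group_def)
    have \<phi>_bdry: "\<phi> (bdry D (Suc n) c) = \<one>\<^bsub>G\<^esub>" if "c \<in> carrier (chains D (Suc n))" for c
      using \<phi> that unfolding cocycles_def cobdry_def Hom_group_def
      by (auto dest!: fun_cong[where x = c])
    have \<phi>_mult: "\<phi> (x \<otimes>\<^bsub>chains D n\<^esub> y) = \<phi> x \<otimes>\<^bsub>G\<^esub> \<phi> y"
      if "x \<in> carrier (chains D n)" "y \<in> carrier (chains D n)" for x y
      using hom_mult[OF \<phi>_hom that] .
    have h: "?h \<in> carrier ?H"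
      using hom_in_carrier[OF hom_precompose[OF C F] \<phi>_carrier] .
    have FD: "F n c \<in> carrier (chains D n)" if "c \<in> carrier (chains C n)" for n c
      using hom_in_carrier[OF F that] .
    have PD: "P n c \<in> carrier (chains D (Suc n))" if "c \<in> carrier (chains C n)" for n c
      using hom_in_carrier[OF P that] .
    \<comment> \<open>It suffices that the two pulled back cochains differ by a coboundary
      \<open>b\<close>, which the coset absorbs. In degree 0 only the unit is available, and there
      the cochains are equal.\<close>
    obtain b where b: "b \<in> coboundaries C G n" "?h' = b \<otimes>\<^bsub>?H\<^esub> ?h"
    proof (cases n)
      case 0
      have "?h' = \<one>\<^bsub>?H\<^esub> \<otimes>\<^bsub>?H\<^esub> ?h"
        using 0 FD[of _ 0] PD[of _ 0] hom_in_carrier[OF bD] \<phi>_bdry htpy_0 \<phi>_mult hom_in_carrier[OF \<phi>_hom]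
        by (auto simp: Hom_group_def fun_eq_iff)
      then show ?thesis
        using that 0 by auto
    next
      case (Suc m)
      \<comment> \<open>The summand \<open>bdry D (Suc n) (P n c)\<close> is killed by \<phi>; what
        remains of the homotopy is \<phi> after \<open>P m\<close> after the boundary, which is the
        coboundary of this cochain.\<close>
      let ?\<psi> = "\<lambda>c\<in>carrier (chains C m). \<phi> (P m c)"
      have "?\<psi> \<in> carrier (Hom_group (chains C m) G)"
        using hom_in_carrier[OF hom_precompose[OF C P]] \<phi>_carrier Suc by auto
      moreover have "?h' = cobdry C m ?\<psi> \<otimes>\<^bsub>?H\<^esub> ?h"
      proof -
        have "\<phi> (F' n c) = \<phi> (P m (bdry C n c)) \<otimes>\<^bsub>G\<^esub> \<phi> (F n c)" if c: "c \<in> carrier (chains C n)" for c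
        proof -
          have 1: "P m (bdry C n c) \<in> carrier (chains D n)"
            "bdry D (Suc n) (P n c) \<in> carrier (chains D n)" "F n c \<in> carrier (chains D n)"
            using hom_in_carrier[OF bC] PD hom_in_carrier[OF bD] FD c Suc by auto
          then have "bdry D (Suc n) (P n c) \<otimes>\<^bsub>chains D n\<^esub> F n c \<in> carrier (chains D n)"
            using group.is_monoid[OF D] by (intro monoid.m_closed)
          then show ?thesis
            using 1 htpy_Suc[of c m] c Suc \<phi>_bdry[OF PD[OF c]] hom_in_carrier[OF \<phi>_hom]
            by (simp add: \<phi>_mult[unfolded Suc])
        qed
        then show ?thesis
          using Suc hom_in_carrier[OF bC, of _ m]
          by (auto simp: Hom_group_def cobdry_def fun_eq_iff)
      qed
      ultimately show ?thesis
        using that Suc by auto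
    qed
    have "coboundaries C G n #>\<^bsub>?H\<^esub> ?h' = coboundaries C G n #>\<^bsub>?H\<^esub> b #>\<^bsub>?H\<^esub> ?h"
      unfolding b(2) using b(1) h by (intro H.coset_mult_assoc[symmetric] B.subset) auto
    also have "coboundaries C G n #>\<^bsub>?H\<^esub> b = coboundaries C G n"
      using b(1) by (intro H.coset_join2 B.subgroup_axioms) auto
    finally have "coboundaries C G n #>\<^bsub>?H\<^esub> ?h' = coboundaries C G n #>\<^bsub>?H\<^esub> ?h" .
    moreover have "cohomology_map C D F G n K = coboundaries C G n #>\<^bsub>?H\<^esub> ?h"
      unfolding K by (rule cohomology_map_coset[OF G C D bC bD F chain \<phi>])
    moreover have "cohomology_map C D F' G n K = coboundaries C G n #>\<^bsub>?H\<^esub> ?h'"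
      unfolding K by (rule cohomology_map_coset[OF G C D bC bD F' chain' \<phi>])
    ultimately show ?thesis
      by simp
  qed (simp add: cohomology_map_def)
qed

section \<open>Continuous maps of closure spaces\<close>

text \<open>If x is outside the closure of A, then the complement of A is a neighborhood of x
  missing A; conversely, a set missing N lies in the complement of N, whose closure avoids
  x.\<close>

lemma cl_iff_nbhd:
  assumes "closure_space X" "A \<subseteq> pts X"
  shows "x \<in> cl X A \<longleftrightarrow> x \<in> pts X \<and> (\<forall>N. nbhd X x N \<longrightarrow> N \<inter> A \<noteq> {})"
proof (intro iffI conjI allI impI)
  assume "x \<in> cl X A"
  moreover have "cl X A \<subseteq> pts X"
    using assms by (simp add: closure_space_def)
  ultimately show "x \<in> pts X" ..
next
  fix N assume x: "x \<in> cl X A" and N: "nbhd X x N"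
  show "N \<inter> A \<noteq> {}"
  proof
    assume "N \<inter> A = {}"
    then have "cl X A \<subseteq> cl X (pts X - N)"
      using assms by (intro cl_mono) auto
    then show False
      using x N by (auto simp: nbhd_def cint_def)
  qed
next
  assume x: "x \<in> pts X \<and> (\<forall>N. nbhd X x N \<longrightarrow> N \<inter> A \<noteq> {})"
  show "x \<in> cl X A"
  proof (rule ccontr)
    assume "x \<notin> cl X A"
    then have "nbhd X x (pts X - A)"
      using x assms(2) by (simp add: nbhd_def cint_def double_diff)
    then show False
      using x by blast
  qed
qed

text \<open>The form of continuity suited to the products, whose closures are given by neighborhood
  bases. For the forward direction, continuity is applied to the set of points mapped outside
  V.\<close>

lemma cmap_iff_nbhd:
  assumes X: "closure_space X" and Y: "closure_space Y"
  shows "cmap X Y f \<longleftrightarrow> f \<in> pts X \<rightarrow> pts Y \<and>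
    (\<forall>x V. x \<in> pts X \<longrightarrow> nbhd Y (f x) V \<longrightarrow> nbhd X x {z \<in> pts X. f z \<in> V})"
    (is "_ \<longleftrightarrow> ?R")
proof
  assume f: "cmap X Y f"
  have "nbhd X x {z \<in> pts X. f z \<in> V}" if x: "x \<in> pts X" and V: "nbhd Y (f x) V" for x V
  proof -
    let ?A = "{z \<in> pts X. f z \<notin> V}"
    have "f ` cl X ?A \<subseteq> cl Y (f ` ?A)"
      using f by (auto simp: cmap_def)
    moreover have "cl Y (f ` ?A) \<subseteq> cl Y (pts Y - V)"
      using f by (intro cl_mono Y) (auto simp: cmap_def)
    moreover have "pts X - {z \<in> pts X. f z \<in> V} = ?A"
      by blast
    ultimately show ?thesis
      using x V unfolding nbhd_def cint_def by auto
  qed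
  then show ?R
    using f by (auto simp: cmap_def)
next
  assume R: ?R
  have "f x \<in> cl Y (f ` A)" if A: "A \<subseteq> pts X" and x: "x \<in> cl X A" for A x
  proof -
    have "N \<inter> f ` A \<noteq> {}" if N: "nbhd Y (f x) N" for N
    proof -
      have "nbhd X x {z \<in> pts X. f z \<in> N}"
        using R N x cl_iff_nbhd[OF X A] by blast
      then have "{z \<in> pts X. f z \<in> N} \<inter> A \<noteq> {}"
        using x cl_iff_nbhd[OF X A] by blast
      then show ?thesis by blast
    qed
    moreover have "f ` A \<subseteq> pts Y" "f x \<in> pts Y"
      using R A x cl_iff_nbhd[OF X A] by auto
    ultimately show ?thesis
      using cl_iff_nbhd[OF Y] by blast
  qed
  then show "cmap X Y f"
    using R by (auto simp: cmap_def)
qed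

lemma nbhd_mono:
  assumes "closure_space X" "nbhd X x U" "U \<subseteq> V" "V \<subseteq> pts X"
  shows "nbhd X x V"
proof -
  have "cl X (pts X - V) \<subseteq> cl X (pts X - U)"
    using assms by (intro cl_mono) auto
  then show ?thesis
    using assms by (auto simp: nbhd_def cint_def)
qed

lemma cmap_in_pts: "cmap X Y f \<Longrightarrow> x \<in> pts X \<Longrightarrow> f x \<in> pts Y"
  by (auto simp: cmap_def)

lemma cmap_nbhd:
  assumes "closure_space X" "closure_space Y" "cmap X Y f" "x \<in> pts X" "nbhd Y (f x) V"
  shows "nbhd X x {z \<in> pts X. f z \<in> V}"
  using assms(3-5) unfolding cmap_iff_nbhd[OF assms(1,2)] by simp

text \<open>Closures of subsets stay among the points, so continuity sees only values there. This is
  what permits restricting singular maps and replacing a composite by a simpler formula.\<close>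

lemma cmap_cong:
  assumes "closure_space X" "\<And>x. x \<in> pts X \<Longrightarrow> f x = g x" "cmap X Y f"
  shows "cmap X Y g"
  unfolding cmap_def
proof (intro conjI allI impI)
  show "g \<in> pts X \<rightarrow> pts Y"
    using assms(2)[symmetric] assms(3) by (auto simp: cmap_def)
  fix A assume A: "A \<subseteq> pts X"
  then have "cl X A \<subseteq> pts X"
    using assms(1) by (simp add: closure_space_def)
  then have "f ` cl X A = g ` cl X A" "f ` A = g ` A"
    using A assms(2) by (auto intro!: image_cong simp: subset_iff)
  then show "g ` cl X A \<subseteq> cl Y (g ` A)"
    using assms(3) A by (metis cmap_def)
qed

lemma cmap_restrict:
  assumes "closure_space X" "cmap X Y f"
  shows "restrict f (pts X) \<in> cmaps X Y"
  using cmap_cong[OF assms(1) _ assms(2), of "restrict f (pts X)"] by (simp add: cmaps_def)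

lemma cmap_compose:
  assumes f: "cmap X Y f" and g: "cmap Y Z g"
  shows "cmap X Z (\<lambda>x. g (f x))"
  unfolding cmap_def
proof (intro conjI allI impI)
  show "(\<lambda>x. g (f x)) \<in> pts X \<rightarrow> pts Z"
    using f g by (auto simp: cmap_def)
  fix A assume A: "A \<subseteq> pts X"
  then have "f ` cl X A \<subseteq> cl Y (f ` A)" and "f ` A \<subseteq> pts Y"
    using f by (auto simp: cmap_def)
  moreover from this(2) have "g ` cl Y (f ` A) \<subseteq> cl Z (g ` f ` A)"
    using g by (simp add: cmap_def)
  ultimately show "(\<lambda>x. g (f x)) ` cl X A \<subseteq> cl Z ((\<lambda>x. g (f x)) ` A)"
    by (simp add: image_image[symmetric]) (meson image_mono order_trans)
qed

lemma cmap_id: "cmap X X (\<lambda>x. x)"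
  by (simp add: cmap_def)

section \<open>Maps into and between products, and transported spaces\<close>

lemma closure_space_tensor:
  "closure_space X \<Longrightarrow> closure_space Y \<Longrightarrow> closure_space (tensor T X Y)"
  by (cases T) (simp_all add: closure_space_prod_space closure_space_box_space)

text \<open>The preimage of a rectangle is the intersection of two neighborhoods. The preimage of a
  cross would consist of points at which f or g keeps its value at the center; for the diagonal of
  the unit interval this is a single point and not a neighborhood.\<close>

lemma cmap_Pair:
  assumes Z: "closure_space Z" and X: "closure_space X" and Y: "closure_space Y"
    and f: "cmap Z X f" and g: "cmap Z Y g"
  shows "cmap Z (prod_space X Y) (\<lambda>z. (f z, g z))"
  unfolding cmap_iff_nbhd[OF Z closure_space_prod_space[OF X Y]]
proof (intro conjI allI impI)
  show "(\<lambda>z. (f z, g z)) \<in> pts Z \<rightarrow> pts (prod_space X Y)"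
    using f g pts_tensor[of Product X Y] by (auto simp: cmap_def)
next
  fix z W assume z: "z \<in> pts Z" and "nbhd (prod_space X Y) (f z, g z) W"
  then obtain U V where "nbhd X (f z) U" "nbhd Y (g z) V" "U \<times> V \<subseteq> W"
    using nbhd_prod_space[OF X Y] by blast
  then have "nbhd Z z ({z \<in> pts Z. f z \<in> U} \<inter> {z \<in> pts Z. g z \<in> V})"
    using z f g by (intro nbhd_Int cmap_nbhd[OF Z X] cmap_nbhd[OF Z Y] Z) auto
  then show "nbhd Z z {z \<in> pts Z. (f z, g z) \<in> W}"
    by (rule nbhd_mono[OF Z]) (use \<open>U \<times> V \<subseteq> W\<close> in auto)
qed

text \<open>Acting on each factor separately, the map respects rectangles and also the two arms of a
  cross, so one statement covers both products.\<close>

lemma cmap_map_prod: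
  assumes X: "closure_space X" and X': "closure_space X'"
    and Y: "closure_space Y" and Y': "closure_space Y'"
    and f: "cmap X X' f" and g: "cmap Y Y' g"
  shows "cmap (tensor T X Y) (tensor T X' Y') (map_prod f g)"
  unfolding cmap_iff_nbhd[OF closure_space_tensor[OF X Y] closure_space_tensor[OF X' Y']]
proof (intro conjI allI impI)
  show "map_prod f g \<in> pts (tensor T X Y) \<rightarrow> pts (tensor T X' Y')"
    using f g by (auto simp: pts_tensor cmap_def)
next
  fix z W assume "z \<in> pts (tensor T X Y)" and "nbhd (tensor T X' Y') (map_prod f g z) W"
  moreover obtain x y where "z = (x, y)"
    by (cases z)
  ultimately have xy: "x \<in> pts X" "y \<in> pts Y" and W: "nbhd (tensor T X' Y') (f x, g y) W"
    and z: "z = (x, y)"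
    by (auto simp: pts_tensor)
  have *: "nbhd X x {a \<in> pts X. f a \<in> U}" "nbhd Y y {b \<in> pts Y. g b \<in> V}"
    if "nbhd X' (f x) U" "nbhd Y' (g y) V" for U V
    using cmap_nbhd[OF X X' f xy(1)] cmap_nbhd[OF Y Y' g xy(2)] that by auto
  show "nbhd (tensor T X Y) z {p \<in> pts (tensor T X Y). map_prod f g p \<in> W}"
  proof (cases T)
    case Product
    with W obtain U V where UV: "nbhd X' (f x) U" "nbhd Y' (g y) V" "U \<times> V \<subseteq> W"
      using nbhd_prod_space[OF X' Y'] by auto
    have "{a \<in> pts X. f a \<in> U} \<times> {b \<in> pts Y. g b \<in> V} \<subseteq>
        {p \<in> pts (tensor T X Y). map_prod f g p \<in> W}"
      using UV(3) by (auto simp: pts_tensor)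
    then show ?thesis
      using *[OF UV(1,2)] Product z pts_tensor[of Product X Y]
      unfolding z Product tensor.simps nbhd_prod_space[OF X Y] by auto
  next
    case Inductive_Product
    with W obtain U V where UV: "nbhd X' (f x) U" "nbhd Y' (g y) V"
        "{f x} \<times> V \<union> U \<times> {g y} \<subseteq> W"
      using nbhd_box_space[OF X' Y'] by auto
    have "{x} \<times> {b \<in> pts Y. g b \<in> V} \<union> {a \<in> pts X. f a \<in> U} \<times> {y} \<subseteq>
        {p \<in> pts (tensor T X Y). map_prod f g p \<in> W}"
      using UV(3) xy by (auto simp: pts_tensor)
    then show ?thesis
      using *[OF UV(1,2)] pts_tensor[of Inductive_Product X Y]
      unfolding z Inductive_Product tensor.simps nbhd_box_space[OF X Y] by auto
  qed
qed

text \<open>Only the part of a neighborhood at height y matters. It contains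
  \<open>U \<times> {y}\<close> in both cases: as one arm of the cross, or because y lies in
  V.\<close>

lemma cmap_slice:
  assumes X: "closure_space X" and Y: "closure_space Y" and y: "y \<in> pts Y"
  shows "cmap X (tensor T X Y) (\<lambda>x. (x, y))"
  unfolding cmap_iff_nbhd[OF X closure_space_tensor[OF X Y]]
proof (intro conjI allI impI)
  show "(\<lambda>x. (x, y)) \<in> pts X \<rightarrow> pts (tensor T X Y)"
    using y by (auto simp: pts_tensor)
next
  fix x W assume "x \<in> pts X" and W: "nbhd (tensor T X Y) (x, y) W"
  obtain U where U: "nbhd X x U" "U \<times> {y} \<subseteq> W"
  proof (cases T)
    case Product
    with W obtain U V where "nbhd X x U" "nbhd Y y V" "U \<times> V \<subseteq> W"
      using nbhd_prod_space[OF X Y] by auto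
    then show ?thesis
      using that nbhd_mem[OF Y] by blast
  next
    case Inductive_Product
    with W obtain U V where "nbhd X x U" "nbhd Y y V" "{x} \<times> V \<union> U \<times> {y} \<subseteq> W"
      using nbhd_box_space[OF X Y] by auto
    then show ?thesis
      using that by blast
  qed
  then show "nbhd X x {z \<in> pts X. (z, y) \<in> W}"
    by (intro nbhd_mono[OF X U(1)]) (auto simp: nbhd_def)
qed

lemma closure_space_transport:
  assumes "closure_space X" "inj_on h (pts X)"
  shows "closure_space (transport h X)"
  unfolding closure_space_def
proof (intro conjI allI impI)
  have cl: "A \<subseteq> pts X \<Longrightarrow> cl X A \<subseteq> pts X" "A \<subseteq> pts X \<Longrightarrow> A \<subseteq> cl X A" "cl X {} = {}"
    "A \<subseteq> pts X \<Longrightarrow> B \<subseteq> pts X \<Longrightarrow> cl X (A \<union> B) = cl X A \<union> cl X B" for A B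
    using assms(1) by (simp_all add: closure_space_def)
  show "cl (transport h X) {} = {}"
    by (simp add: transport_def cl)
  fix A
  show "cl (transport h X) A \<subseteq> pts (transport h X)"
    using cl(1)[of "{p \<in> pts X. h p \<in> A}"] by (auto simp: transport_def)
  show "A \<subseteq> cl (transport h X) A" if "A \<subseteq> pts (transport h X)"
    using that cl(2)[of "{p \<in> pts X. h p \<in> A}"] by (fastforce simp: transport_def)
  fix B
  have "{p \<in> pts X. h p \<in> A \<union> B} = {p \<in> pts X. h p \<in> A} \<union> {p \<in> pts X. h p \<in> B}"
    by blast
  then show "cl (transport h X) (A \<union> B) = cl (transport h X) A \<union> cl (transport h X) B"
    by (simp only: transport_def cspace.simps) (subst cl, auto)
qed

lemma cmap_into_transport:
  assumes "closure_space X"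
  shows "cmap X (transport h X) h"
  unfolding cmap_def
proof (intro conjI allI impI)
  fix A assume "A \<subseteq> pts X"
  then have "cl X A \<subseteq> cl X {p \<in> pts X. h p \<in> h ` A}"
    by (intro cl_mono assms) auto
  then show "h ` cl X A \<subseteq> cl (transport h X) (h ` A)"
    by (auto simp: transport_def)
qed (auto simp: transport_def)

text \<open>A subset of the transported space is the image of its preimage, and its closure is the
  image of the closure of that preimage, so continuity can be tested on X. Maps out of a cube are
  thereby handled as maps out of a product.\<close>

lemma cmap_from_transport:
  assumes "cmap X Y (\<lambda>x. k (h x))"
  shows "cmap (transport h X) Y k"
  unfolding cmap_def
proof (intro conjI allI impI)
  show "k \<in> pts (transport h X) \<rightarrow> pts Y"
    using assms by (auto simp: transport_def cmap_def)
  fix A assume "A \<subseteq> pts (transport h X)"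
  then have "(\<lambda>x. k (h x)) ` {p \<in> pts X. h p \<in> A} = k ` A"
    by (fastforce simp: transport_def)
  moreover have "(\<lambda>x. k (h x)) ` cl X {p \<in> pts X. h p \<in> A} \<subseteq>
      cl Y ((\<lambda>x. k (h x)) ` {p \<in> pts X. h p \<in> A})"
    using assms by (auto simp: cmap_def)
  ultimately show "k ` cl (transport h X) A \<subseteq> cl Y (k ` A)"
    by (auto simp: transport_def)
qed

section \<open>Topological, indiscrete and upward spaces\<close>

lemma closure_space_of_topology: "closure_space (of_topology S)"
  by (simp add: closure_space_def of_topology_def closure_of_Un closure_of_subset_topspace
      closure_of_subset)

lemma closure_space_indiscrete_space: "closure_space (indiscrete_space S)"
  by (auto simp: closure_space_def indiscrete_space_def)

lemma closure_space_upward_space: "closure_space (upward_space S)"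
  by (auto simp: closure_space_def upward_space_def)

lemma closure_space_interval: "closure_space (interval J)"
  by (cases J) (simp_all add: closure_space_of_topology closure_space_indiscrete_space
      closure_space_upward_space)

lemma cmap_of_topology:
  assumes "continuous_map S S' f"
  shows "cmap (of_topology S) (of_topology S') f"
  using continuous_map_image_closure_subset[OF assms] continuous_map_funspace[OF assms]
  by (simp add: cmap_def of_topology_def)

lemma cmap_indiscrete_space:
  assumes "closure_space X" "f \<in> pts X \<rightarrow> S"
  shows "cmap X (indiscrete_space S) f"
proof -
  have "cl X {} = {}" "\<And>A. A \<subseteq> pts X \<Longrightarrow> cl X A \<subseteq> pts X"
    using assms(1) by (simp_all add: closure_space_def)
  then show ?thesis
    using assms(2) by (auto simp: cmap_def indiscrete_space_def)
qed

lemma cmap_upward_space: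
  assumes "f \<in> S \<rightarrow> S'" "\<And>x y. x \<in> S \<Longrightarrow> y \<in> S \<Longrightarrow> x \<le> y \<Longrightarrow> f x \<le> f y"
  shows "cmap (upward_space S) (upward_space S') f"
proof -
  have "f j \<in> S' \<and> (\<exists>i\<in>A. f i \<le> f j)" if "A \<subseteq> S" "j \<in> S" "i \<in> A" "i \<le> j" for A i j
    using that assms by blast
  then show ?thesis
    using assms(1) by (auto simp: cmap_def upward_space_def)
qed

lemma interval_endpoints: "0 \<in> pts (interval J)" "1 \<in> pts (interval J)"
  by (cases J; simp add: of_topology_def indiscrete_space_def upward_space_def)+

section \<open>Singular simplices\<close>

lemma hom_frag_extend:
  assumes "\<And>\<sigma>. \<sigma> \<in> S \<Longrightarrow> Poly_Mapping.keys (k \<sigma>) \<subseteq> S'"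
  shows "frag_extend k \<in> hom (free_Abelian_group S) (free_Abelian_group S')"
proof (rule homI)
  fix c assume "c \<in> carrier (free_Abelian_group S)"
  then show "frag_extend k c \<in> carrier (free_Abelian_group S')"
    using assms keys_frag_extend[of k c] by fastforce
qed (simp add: frag_extend_add)

lemma keys_sum_cmul:
  assumes "\<And>i. i \<in> I \<Longrightarrow> Poly_Mapping.keys (u i) \<subseteq> S"
  shows "Poly_Mapping.keys (\<Sum>i\<in>I. frag_cmul (a i) (u i)) \<subseteq> S"
  using assms by (intro subset_trans[OF keys_sum]) (auto simp: keys_cmul)

lemma frag_extend_lincomb:
  "frag_extend k (\<Sum>i\<in>I. frag_cmul (a i) (u i)) = (\<Sum>i\<in>I. frag_cmul (a i) (frag_extend k (u i)))"
  by (induction I rule: infinite_finite_induct) (simp_all add: frag_extend_add frag_extend_cmul)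

lemma push_forward_of: "push_forward P f (frag_of \<sigma>) = frag_of (restrict (f \<circ> \<sigma>) (pts P))"
  by (simp add: push_forward_def)

lemma push_forward_0: "push_forward P f 0 = 0"
  by (simp add: push_forward_def)

lemma push_forward_diff: "push_forward P f (a - b) = push_forward P f a - push_forward P f b"
  by (simp add: push_forward_def frag_extend_diff)

lemma push_forward_sum:
  "push_forward P f (\<Sum>i\<in>I. frag_cmul (a i) (u i)) = (\<Sum>i\<in>I. frag_cmul (a i) (push_forward P f (u i)))"
  by (simp add: push_forward_def frag_extend_lincomb)

lemma hom_push_forward:
  assumes "closure_space P" "cmap X Y f"
  shows "push_forward P f \<in> hom (free_Abelian_group (cmaps P X)) (free_Abelian_group (cmaps P Y))"
  unfolding push_forward_def
proof (rule hom_frag_extend)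
  fix \<sigma> assume "\<sigma> \<in> cmaps P X"
  then show "Poly_Mapping.keys (frag_of (restrict (f \<circ> \<sigma>) (pts P))) \<subseteq> cmaps P Y"
    using cmap_restrict[OF assms(1) cmap_compose[OF _ assms(2)], of \<sigma>]
    by (simp add: cmaps_def o_def)
qed

text \<open>The sum on the left is the boundary of a prism: the terms off the diagonal are the prism over the
  boundary, and those on the diagonal telescope.\<close>

lemma prism_sum:
  fixes A B :: "nat \<Rightarrow> nat \<Rightarrow> 'z \<Rightarrow>\<^sub>0 int"
  assumes diag: "\<And>i. i \<le> Suc n \<Longrightarrow> A i i = c i" "\<And>i. i \<le> Suc n \<Longrightarrow> A i (Suc i) = c (Suc i)"
    and lower: "\<And>i j. j < i \<Longrightarrow> i \<le> Suc n \<Longrightarrow> A i j = B j (i - 1)"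
    and upper: "\<And>i j. Suc i < j \<Longrightarrow> j \<le> Suc (Suc n) \<Longrightarrow> A i j = B (j - 1) i"
  shows "(\<Sum>i\<le>Suc n. \<Sum>j\<le>Suc (Suc n). frag_cmul ((-1) ^ i * (-1) ^ j) (A i j)) =
    c 0 - c (Suc (Suc n)) - (\<Sum>j\<le>Suc n. \<Sum>i\<le>n. frag_cmul ((-1) ^ j * (-1) ^ i) (B j i))"
proof -
  let ?a = "\<lambda>(i, j). frag_cmul ((-1) ^ i * (-1) ^ j) (A i j)"
  let ?b = "\<lambda>(j, i). frag_cmul ((-1) ^ j * (-1) ^ i) (B j i)"
  let ?L = "{(i, j). j < i \<and> i \<le> Suc n}" and ?U = "{(i, j). Suc i < j \<and> j \<le> Suc (Suc n)}"
  let ?M = "Sigma {..Suc n} (\<lambda>i. {i, Suc i})"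
  let ?L' = "{(j, i). j \<le> i \<and> i \<le> n}" and ?U' = "{(j, i). i < j \<and> j \<le> Suc n}"
  have fin: "finite ?L" "finite ?U" "finite ?L'" "finite ?U'"
    by (auto intro: finite_subset[where B = "{..Suc (Suc n)} \<times> {..Suc (Suc n)}"])
  have sq: "(-1) ^ i * (-1) ^ i = (1 :: int)" for i :: nat
    by (simp flip: power_mult_distrib)
  have "sum ?a ?M = (\<Sum>i\<le>Suc n. \<Sum>j\<in>{i, Suc i}. ?a (i, j))"
    by (subst sum.Sigma) auto
  also have "\<dots> = (\<Sum>i\<le>Suc n. c i - c (Suc i))"
    by (intro sum.cong refl) (simp add: diag sq)
  also have "\<dots> = c 0 - c (Suc (Suc n))"
    by (rule sum_telescope)
  finally have M: "sum ?a ?M = c 0 - c (Suc (Suc n))" .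
  \<comment> \<open>Below the diagonal, pairs correspond to pieces of the prism over the boundary
    after lowering i by one. This shift by one changes the sign; above the diagonal the same happens
    with j.\<close>
  have "?L = (\<lambda>(j, i). (Suc i, j)) ` ?L'"
  proof (rule Set.set_eqI)
    fix p show "p \<in> ?L \<longleftrightarrow> p \<in> (\<lambda>(j, i). (Suc i, j)) ` ?L'"
      by (cases p; cases "fst p") (auto simp: image_iff Bex_def split_paired_Ex)
  qed
  moreover have "inj_on (\<lambda>(j, i). (Suc i, j)) ?L'"
    by (auto simp: inj_on_def)
  ultimately have "sum ?a ?L = sum (?a \<circ> (\<lambda>(j, i). (Suc i, j))) ?L'"
    by (simp only: sum.reindex)
  also have "\<dots> = sum (\<lambda>p. - ?b p) ?L'"
    by (rule sum.cong[OF refl]) (clarsimp simp: lower mult.commute)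
  finally have "sum ?a ?L = sum (\<lambda>p. - ?b p) ?L'" .
  moreover have "sum ?a ?U = sum (\<lambda>p. - ?b p) ?U'"
  proof -
    have "?U = (\<lambda>(j, i). (i, Suc j)) ` ?U'"
    proof (rule Set.set_eqI)
      fix p show "p \<in> ?U \<longleftrightarrow> p \<in> (\<lambda>(j, i). (i, Suc j)) ` ?U'"
        by (cases p; cases "snd p") (auto simp: image_iff Bex_def split_paired_Ex)
    qed
    moreover have "inj_on (\<lambda>(j, i). (i, Suc j)) ?U'"
      by (auto simp: inj_on_def)
    ultimately have "sum ?a ?U = sum (?a \<circ> (\<lambda>(j, i). (i, Suc j))) ?U'"
      by (simp only: sum.reindex)
    also have "\<dots> = sum (\<lambda>p. - ?b p) ?U'"
      by (rule sum.cong[OF refl]) (clarsimp simp: upper mult.commute)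
    finally show ?thesis .
  qed
  moreover have "sum ?b ({..Suc n} \<times> {..n}) = sum ?b (?L' \<union> ?U')"
    by (rule sum.cong) auto
  moreover have "\<dots> = sum ?b ?L' + sum ?b ?U'"
    by (rule sum.union_disjoint[OF fin(3,4)]) auto
  ultimately have LU: "sum ?a ?L + sum ?a ?U = - sum ?b ({..Suc n} \<times> {..n})"
    by (simp only: sum_negf minus_add_distrib)
  have "sum ?a ({..Suc n} \<times> {..Suc (Suc n)}) = sum ?a (?M \<union> (?L \<union> ?U))"
    by (rule sum.cong) auto
  also have "\<dots> = sum ?a ?M + sum ?a (?L \<union> ?U)"
    by (rule sum.union_disjoint[OF _ finite_UnI[OF fin(1,2)]]) auto
  also have "sum ?a (?L \<union> ?U) = sum ?a ?L + sum ?a ?U"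
    by (rule sum.union_disjoint[OF fin(1,2)]) auto
  finally show ?thesis
    unfolding M LU by (simp add: sum.cartesian_product del: sum.atMost_Suc)
qed

text \<open>\<open>s i\<close> is the \<open>i\<close>-th degeneracy map, and \<open>t m\<close> sends the vertices below \<open>m\<close> to 0 and the
  others to 1.\<close>

locale simplicial_model =
  fixes \<Delta> :: "nat \<Rightarrow> 'd cspace" and d s :: "nat \<Rightarrow> 'd \<Rightarrow> 'd" and t :: "nat \<Rightarrow> 'd \<Rightarrow> real"
    and J :: interval_kind
  assumes closure_space: "closure_space (\<Delta> n)"
    and cmap_d: "j \<le> Suc n \<Longrightarrow> cmap (\<Delta> n) (\<Delta> (Suc n)) (d j)"
    and cmap_s: "i \<le> n \<Longrightarrow> cmap (\<Delta> (Suc n)) (\<Delta> n) (s i)"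
    and cmap_t: "cmap (\<Delta> n) (interval J) (t m)"
    and s_d_same: "x \<in> pts (\<Delta> n) \<Longrightarrow> s i (d i x) = x" "x \<in> pts (\<Delta> n) \<Longrightarrow> s i (d (Suc i) x) = x"
    and s_d_less: "x \<in> pts (\<Delta> n) \<Longrightarrow> j < i \<Longrightarrow> s i (d j x) = d j (s (i - 1) x)"
    and s_d_greater: "x \<in> pts (\<Delta> n) \<Longrightarrow> Suc i < j \<Longrightarrow> s i (d j x) = d (j - 1) (s i x)"
    and t_0: "x \<in> pts (\<Delta> n) \<Longrightarrow> t 0 x = 1"
    and t_Suc: "x \<in> pts (\<Delta> n) \<Longrightarrow> t (Suc n) x = 0"
    and t_d_less: "x \<in> pts (\<Delta> n) \<Longrightarrow> j < m \<Longrightarrow> t m (d j x) = t (m - 1) x"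
    and t_d_ge: "x \<in> pts (\<Delta> n) \<Longrightarrow> m \<le> j \<Longrightarrow> t m (d j x) = t m x"
begin

section \<open>The prism operator over an abstract family of simplices\<close>

abbreviation chain_group :: "'a cspace \<Rightarrow> nat \<Rightarrow> (('d \<Rightarrow> 'a) \<Rightarrow>\<^sub>0 int) monoid" where
  "chain_group X n \<equiv> free_Abelian_group (cmaps (\<Delta> n) X)"

text \<open>For the topological simplex, x \<mapsto> \<open>(s i x, t (Suc i) x)\<close> is the i-th
  piece of the usual triangulation of the prism: it is affine, sends vertex k to (v_k, 0) for k
  \<le> i and to (v_{k-1}, 1) for k > i.\<close>

definition prism :: "('a \<times> real \<Rightarrow> 'b) \<Rightarrow> nat \<Rightarrow> (('d \<Rightarrow> 'a) \<Rightarrow>\<^sub>0 int) \<Rightarrow> (('d \<Rightarrow> 'b) \<Rightarrow>\<^sub>0 int)" where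
  "prism H n = frag_extend (\<lambda>\<sigma>. \<Sum>i\<le>n. frag_cmul ((-1) ^ i)
     (frag_of (restrict (\<lambda>x. H (\<sigma> (s i x), t (Suc i) x)) (pts (\<Delta> (Suc n))))))"

lemma d_in_pts: "x \<in> pts (\<Delta> n) \<Longrightarrow> j \<le> Suc n \<Longrightarrow> d j x \<in> pts (\<Delta> (Suc n))"
  using cmap_in_pts[OF cmap_d] .

lemma s_in_pts: "x \<in> pts (\<Delta> (Suc n)) \<Longrightarrow> i \<le> n \<Longrightarrow> s i x \<in> pts (\<Delta> n)"
  using cmap_in_pts[OF cmap_s] .

lemma hom_simplicial_boundary:
  "simplicial_boundary \<Delta> d (Suc n) \<in> hom (chain_group X (Suc n)) (chain_group X n)"
  unfolding simplicial_boundary_def if_not_P[OF Suc_not_Zero]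
proof (intro hom_frag_extend keys_sum_cmul)
  fix \<sigma> j assume "\<sigma> \<in> cmaps (\<Delta> (Suc n)) X" "j \<in> {..Suc n}"
  then have "restrict (\<lambda>x. \<sigma> (d j x)) (pts (\<Delta> n)) \<in> cmaps (\<Delta> n) X"
    by (intro cmap_restrict closure_space cmap_compose[OF cmap_d]) (auto simp: cmaps_def)
  then show "Poly_Mapping.keys (frag_of (restrict (\<sigma> \<circ> d j) (pts (\<Delta> (Suc n - 1))))) \<subseteq> cmaps (\<Delta> n) X"
    by (simp add: o_def)
qed

lemma simplicial_boundary_of:
  "simplicial_boundary \<Delta> d (Suc n) (frag_of \<sigma>) =
    (\<Sum>j\<le>Suc n. frag_cmul ((-1) ^ j) (frag_of (restrict (\<sigma> \<circ> d j) (pts (\<Delta> n)))))"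
  by (simp add: simplicial_boundary_def del: sum.atMost_Suc)

lemma simplicial_boundary_diff:
  "simplicial_boundary \<Delta> d n (a - b) = simplicial_boundary \<Delta> d n a - simplicial_boundary \<Delta> d n b"
  by (simp add: simplicial_boundary_def frag_extend_diff)

lemma simplicial_boundary_0: "simplicial_boundary \<Delta> d n 0 = 0"
  by (simp add: simplicial_boundary_def)

lemma simplicial_boundary_sum:
  "simplicial_boundary \<Delta> d n (\<Sum>i\<in>I. frag_cmul (a i) (u i)) =
    (\<Sum>i\<in>I. frag_cmul (a i) (simplicial_boundary \<Delta> d n (u i)))"
  by (simp add: simplicial_boundary_def frag_extend_lincomb)

text \<open>Composition with f on the left commutes with composition with faces on the right; the
  restrictions agree because \<open>d j\<close> lands in the points of the next simplex.\<close>

lemma simplicial_boundary_push_forward: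
  "simplicial_boundary \<Delta> d (Suc n) (push_forward (\<Delta> (Suc n)) f c) =
    push_forward (\<Delta> n) f (simplicial_boundary \<Delta> d (Suc n) c)"
proof (induction c rule: frag_induction[OF subset_UNIV])
  case (2 \<sigma>)
  have "restrict (restrict (f \<circ> \<sigma>) (pts (\<Delta> (Suc n))) \<circ> d j) (pts (\<Delta> n)) =
      restrict (f \<circ> restrict (\<sigma> \<circ> d j) (pts (\<Delta> n))) (pts (\<Delta> n))" if "j \<le> Suc n" for j
    using d_in_pts that by (auto simp: fun_eq_iff)
  then show ?case
    by (auto simp: push_forward_of simplicial_boundary_of push_forward_sum simp del: sum.atMost_Suc
        intro!: sum.cong)
qed (simp_all add: push_forward_0 simplicial_boundary_0 push_forward_diff simplicial_boundary_diff)

lemma hom_prism: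
  assumes X: "closure_space X" and H: "cmap (tensor Product X (interval J)) Y H"
  shows "prism H n \<in> hom (chain_group X n) (chain_group Y (Suc n))"
  unfolding prism_def
proof (intro hom_frag_extend keys_sum_cmul)
  fix \<sigma> i assume "\<sigma> \<in> cmaps (\<Delta> n) X" "i \<in> {..n}"
  then have "cmap (\<Delta> (Suc n)) X (\<lambda>x. \<sigma> (s i x))"
    by (auto intro: cmap_compose[OF cmap_s] simp: cmaps_def)
  \<comment> \<open>Both components depend on the same x, so this is a genuine pairing: the step
    that calls for the product \<times>.\<close>
  then have "cmap (\<Delta> (Suc n)) (tensor Product X (interval J)) (\<lambda>x. (\<sigma> (s i x), t (Suc i) x))"
    unfolding tensor.simps by (intro cmap_Pair closure_space X closure_space_interval cmap_t)
  then have "restrict (\<lambda>x. H (\<sigma> (s i x), t (Suc i) x)) (pts (\<Delta> (Suc n))) \<in> cmaps (\<Delta> (Suc n)) Y"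
    by (intro cmap_restrict closure_space cmap_compose[OF _ H])
  then show "Poly_Mapping.keys (frag_of (restrict (\<lambda>x. H (\<sigma> (s i x), t (Suc i) x)) (pts (\<Delta> (Suc n)))))
      \<subseteq> cmaps (\<Delta> (Suc n)) Y"
    by simp
qed

lemma boundary_prism_of:
  "simplicial_boundary \<Delta> d (Suc n) (prism H n (frag_of \<sigma>)) =
    (\<Sum>i\<le>n. \<Sum>j\<le>Suc n. frag_cmul ((-1) ^ i * (-1) ^ j)
      (frag_of (restrict (\<lambda>x. H (\<sigma> (s i (d j x)), t (Suc i) (d j x))) (pts (\<Delta> n)))))"
proof -
  have "restrict (restrict (\<lambda>x. H (\<sigma> (s i x), t (Suc i) x)) (pts (\<Delta> (Suc n))) \<circ> d j) (pts (\<Delta> n)) =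
      restrict (\<lambda>x. H (\<sigma> (s i (d j x)), t (Suc i) (d j x))) (pts (\<Delta> n))" if "j \<le> Suc n" for i j
    using d_in_pts that by (auto simp: fun_eq_iff)
  then show ?thesis
    by (auto simp: prism_def simplicial_boundary_sum simplicial_boundary_of frag_cmul_sum
        simp del: sum.atMost_Suc intro!: sum.cong)
qed

lemma prism_boundary_of:
  "prism H n (simplicial_boundary \<Delta> d (Suc n) (frag_of \<sigma>)) =
    (\<Sum>j\<le>Suc n. \<Sum>i\<le>n. frag_cmul ((-1) ^ j * (-1) ^ i)
      (frag_of (restrict (\<lambda>x. H (\<sigma> (d j (s i x)), t (Suc i) x)) (pts (\<Delta> (Suc n))))))"
proof -
  have "restrict (\<lambda>x. H (restrict (\<sigma> \<circ> d j) (pts (\<Delta> n)) (s i x), t (Suc i) x)) (pts (\<Delta> (Suc n))) =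
      restrict (\<lambda>x. H (\<sigma> (d j (s i x)), t (Suc i) x)) (pts (\<Delta> (Suc n)))" if "i \<le> n" for i j
    using s_in_pts that by (auto simp: fun_eq_iff)
  then show ?thesis
    by (auto simp: prism_def simplicial_boundary_of frag_extend_sum frag_extend_cmul frag_cmul_sum
        simp del: sum.atMost_Suc intro!: sum.cong)
qed

text \<open>The telescoping ends of the boundary of the prism are at \<open>t 0\<close>, constantly
  1, and \<open>t (Suc n)\<close>, constantly 0, hence g and f. The bracketing is that of the chain
  homotopy criterion.\<close>

lemma prism_chain_homotopy:
  assumes H: "\<And>x. x \<in> pts X \<Longrightarrow> H (x, 0) = f x \<and> H (x, 1) = g x"
    and c: "c \<in> carrier (chain_group X n)"
  shows "push_forward (\<Delta> n) g c = (if n = 0 then 0 else prism H (n - 1) (simplicial_boundary \<Delta> d n c)) +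
    (simplicial_boundary \<Delta> d (Suc n) (prism H n c) + push_forward (\<Delta> n) f c)"
proof -
  have "Poly_Mapping.keys c \<subseteq> cmaps (\<Delta> n) X"
    using c by simp
  then show ?thesis
  proof (induction c rule: frag_induction)
    case (one \<sigma>)
    let ?c = "\<lambda>i. frag_of (restrict (\<lambda>x. H (\<sigma> x, t i x)) (pts (\<Delta> n)))"
    have \<sigma>: "\<sigma> x \<in> pts X" if "x \<in> pts (\<Delta> n)" for x
      using one that by (auto simp: cmaps_def cmap_def)
    have "restrict (\<lambda>x. H (\<sigma> x, t 0 x)) (pts (\<Delta> n)) = restrict (g \<circ> \<sigma>) (pts (\<Delta> n))"
      "restrict (\<lambda>x. H (\<sigma> x, t (Suc n) x)) (pts (\<Delta> n)) = restrict (f \<circ> \<sigma>) (pts (\<Delta> n))"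
      using H \<sigma> by (auto simp: fun_eq_iff t_0 t_Suc)
    then have ends: "?c 0 = push_forward (\<Delta> n) g (frag_of \<sigma>)"
      "?c (Suc n) = push_forward (\<Delta> n) f (frag_of \<sigma>)"
      by (simp_all add: push_forward_of)
    let ?A = "\<lambda>i j. frag_of (restrict (\<lambda>x. H (\<sigma> (s i (d j x)), t (Suc i) (d j x))) (pts (\<Delta> n)))"
    \<comment> \<open>Both faces i and i + 1 are undone by the degeneracy \<open>s i\<close>. Face i
      lowers the step \<open>Suc i\<close> to i, face i + 1 leaves it alone, so neighboring pieces
      share a face.\<close>
    have diag: "?A i i = ?c i" "?A i (Suc i) = ?c (Suc i)" for i
      by (auto simp: s_d_same t_d_less t_d_ge cong: restrict_cong)
    show ?case
    proof (cases n)
      case 0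
      then show ?thesis
        using diag[of 0] ends by (simp add: boundary_prism_of)
    next
      case (Suc m)
      have "simplicial_boundary \<Delta> d (Suc n) (prism H n (frag_of \<sigma>)) =
        ?c 0 - ?c (Suc n) - prism H m (simplicial_boundary \<Delta> d (Suc m) (frag_of \<sigma>))"
        unfolding boundary_prism_of prism_boundary_of Suc
        by (intro prism_sum diag[unfolded Suc])
          (auto simp: s_d_less s_d_greater t_d_less t_d_ge cong: restrict_cong)
      then show ?thesis
        using ends unfolding Suc by simp
    qed
  qed (simp_all add: push_forward_0 simplicial_boundary_0 push_forward_diff simplicial_boundary_diff
      prism_def frag_extend_diff)
qed

lemma simplicial_pullback_eq:
  assumes G: "comm_group G" and X: "closure_space X"
    and fg: "one_step_homotopic J Product X Y f g"
  shows "simplicial_pullback \<Delta> d X Y G n f = simplicial_pullback \<Delta> d X Y G n g"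
proof -
  obtain H where H: "cmap (tensor Product X (interval J)) Y H"
      "\<And>x. x \<in> pts X \<Longrightarrow> H (x, 0) = f x \<and> H (x, 1) = g x"
    and f: "cmap X Y f" and g: "cmap X Y g"
    using fg unfolding one_step_homotopic_def by blast
  show ?thesis
    unfolding simplicial_pullback_def
  proof (rule cohomology_map_eq_if_chain_homotopic[where P = "prism H"])
    fix c assume "c \<in> carrier (chains (simplicial_complex \<Delta> d X) 0)"
    then show "push_forward (\<Delta> 0) g c = bdry (simplicial_complex \<Delta> d Y) (Suc 0) (prism H 0 c)
        \<otimes>\<^bsub>chains (simplicial_complex \<Delta> d Y) 0\<^esub> push_forward (\<Delta> 0) f c"
      using prism_chain_homotopy[OF H(2), where c = c and n = 0] by (simp add: simplicial_complex_def)
  next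
    fix n c assume "c \<in> carrier (chains (simplicial_complex \<Delta> d X) (Suc n))"
    then show "push_forward (\<Delta> (Suc n)) g c =
        prism H n (bdry (simplicial_complex \<Delta> d X) (Suc n) c)
        \<otimes>\<^bsub>chains (simplicial_complex \<Delta> d Y) (Suc n)\<^esub>
        (bdry (simplicial_complex \<Delta> d Y) (Suc (Suc n)) (prism H (Suc n) c)
        \<otimes>\<^bsub>chains (simplicial_complex \<Delta> d Y) (Suc n)\<^esub> push_forward (\<Delta> (Suc n)) f c)"
      using prism_chain_homotopy[OF H(2), where c = c and n = "Suc n"] by (simp add: simplicial_complex_def)
  qed (simp_all add: simplicial_complex_def G hom_simplicial_boundary hom_push_forward closure_space f g
      simplicial_boundary_push_forward hom_prism[OF X H(1)])
qed

end

section \<open>Vertex models for the indiscrete and the upward interval\<close>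

definition vertex_degeneracy :: "nat \<Rightarrow> nat \<Rightarrow> nat" where
  "vertex_degeneracy i k = (if k \<le> i then k else k - 1)"

definition vertex_step :: "nat \<Rightarrow> nat \<Rightarrow> real" where
  "vertex_step m k = (if k < m then 0 else 1)"

lemmas vertex_defs = vertex_face_def vertex_degeneracy_def vertex_step_def

lemma simplicial_model_J1:
  "simplicial_model simplex_J1 vertex_face vertex_degeneracy vertex_step Interval_J1"
proof
  show "closure_space (simplex_J1 n)" for n
    by (simp add: simplex_J1_def closure_space_indiscrete_space)
  have *: "cmap (simplex_J1 m) (indiscrete_space S) f"
    if "f \<in> {0..m} \<rightarrow> S" for m S and f :: "nat \<Rightarrow> 'b"
    using that closure_space_indiscrete_space[of "{0..m}"]
    by (intro cmap_indiscrete_space) (simp_all add: simplex_J1_def indiscrete_space_def)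
  show "cmap (simplex_J1 n) (simplex_J1 (Suc n)) (vertex_face j)" if "j \<le> Suc n" for j n
    unfolding simplex_J1_def[of "Suc n"] by (rule *) (auto simp: vertex_defs)
  show "cmap (simplex_J1 (Suc n)) (simplex_J1 n) (vertex_degeneracy i)" if "i \<le> n" for i n
    unfolding simplex_J1_def[of n] using that by (intro *) (auto simp: vertex_defs)
  show "cmap (simplex_J1 n) (interval Interval_J1) (vertex_step m)" for m n
    unfolding interval.simps by (rule *) (auto simp: vertex_defs)
qed (auto simp: simplex_J1_def indiscrete_space_def vertex_defs)

text \<open>Order-preserving maps are continuous for upward closures. This dictates the direction of
  the step: sending early vertices to 1 and late ones to 0 would reverse the order.\<close>

lemma simplicial_model_Jplus:
  "simplicial_model simplex_Jplus vertex_face vertex_degeneracy vertex_step Interval_Jplus"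
proof
  show "closure_space (simplex_Jplus n)" for n
    by (simp add: simplex_Jplus_def closure_space_upward_space)
  show "cmap (simplex_Jplus n) (simplex_Jplus (Suc n)) (vertex_face j)" for j n
    unfolding simplex_Jplus_def by (rule cmap_upward_space) (auto simp: vertex_defs)
  show "cmap (simplex_Jplus (Suc n)) (simplex_Jplus n) (vertex_degeneracy i)" if "i \<le> n" for i n
    using that unfolding simplex_Jplus_def by (intro cmap_upward_space) (auto simp: vertex_defs)
  show "cmap (simplex_Jplus n) (interval Interval_Jplus) (vertex_step m)" for m n
    unfolding simplex_Jplus_def interval.simps
    by (rule cmap_upward_space) (auto simp: vertex_defs)
qed (auto simp: simplex_Jplus_def upward_space_def vertex_defs)

text \<open>In barycentric coordinates \<open>simplex_step m\<close> is \<open>\<Sum>k\<ge>m. x k\<close>, written so that it does not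
  depend on the dimension.\<close>

definition simplex_degeneracy :: "nat \<Rightarrow> (nat \<Rightarrow> real) \<Rightarrow> nat \<Rightarrow> real" where
  "simplex_degeneracy i x k =
     (if k < i then x k else if k = i then x i + x (Suc i) else x (Suc k))"

definition simplex_step :: "nat \<Rightarrow> (nat \<Rightarrow> real) \<Rightarrow> real" where
  "simplex_step m x = 1 - (\<Sum>k<m. x k)"

section \<open>Degeneracies and steps of the topological simplex\<close>

text \<open>The degeneracy merges coordinates i and i + 1 and shifts the later ones, so the total is
  kept. Induction starts at n = i, where the merged coordinate is the last.\<close>

lemma sum_simplex_degeneracy:
  "i \<le> n \<Longrightarrow> (\<Sum>k\<le>n. simplex_degeneracy i x k) = (\<Sum>k\<le>Suc n. x k)"
proof (induction n rule: dec_induct)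
  case base
  have "(\<Sum>k\<le>i. simplex_degeneracy i x k) = (\<Sum>k<i. simplex_degeneracy i x k) + (x i + x (Suc i))"
    by (simp add: simplex_degeneracy_def lessThan_Suc_atMost[symmetric])
  also have "(\<Sum>k<i. simplex_degeneracy i x k) = (\<Sum>k<i. x k)"
    by (intro sum.cong) (auto simp: simplex_degeneracy_def)
  finally show ?case
    by (simp add: lessThan_Suc_atMost[symmetric])
qed (simp add: simplex_degeneracy_def)

lemma simplex_degeneracy_in_standard_simplex:
  assumes "i \<le> n" "x \<in> standard_simplex (Suc n)"
  shows "simplex_degeneracy i x \<in> standard_simplex n"
proof -
  have nonneg: "0 \<le> simplex_degeneracy i x k" for k
    using assms(2) by (auto simp: simplex_degeneracy_def standard_simplex_def)
  have sum: "(\<Sum>k\<le>n. simplex_degeneracy i x k) = 1"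
    using sum_simplex_degeneracy[OF assms(1)] assms(2) by (simp add: standard_simplex_def)
  have zero: "simplex_degeneracy i x k = 0" if "k > n" for k
    using that assms by (auto simp: simplex_degeneracy_def standard_simplex_def)
  have "simplex_degeneracy i x k \<le> 1" for k
  proof (cases "k \<le> n")
    case True
    then show ?thesis
      using member_le_sum[of k "{..n}" "simplex_degeneracy i x"] nonneg sum by simp
  qed (use zero in simp)
  then show ?thesis
    using nonneg sum zero by (auto simp: standard_simplex_def)
qed

lemma simplex_step_bounds:
  assumes "x \<in> standard_simplex n"
  shows "simplex_step m x \<in> {0..1}"
proof -
  \<comment> \<open>Since m is arbitrary, it is enlarged to cover all coordinates up to n; those
    beyond n vanish.\<close>
  have "(\<Sum>k<m. x k) \<le> (\<Sum>k<max m (Suc n). x k)"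
    using assms by (intro sum_mono2) (auto simp: standard_simplex_def)
  also have "\<dots> = (\<Sum>k\<le>n. x k)"
    using assms by (intro sum.mono_neutral_right) (auto simp: standard_simplex_def)
  also have "\<dots> = 1"
    using assms by (simp add: standard_simplex_def)
  finally show ?thesis
    using assms by (auto simp: simplex_step_def standard_simplex_def intro: sum_nonneg)
qed

text \<open>The face map inserts a zero at coordinate j, so a partial sum reaching past j has one
  fewer coordinate of x, and a shorter one is unaffected. The induction starts with the first sum
  that contains the zero.\<close>

lemma simplex_step_face:
  "simplex_step m (simplical_face j x) = simplex_step (if j < m then m - 1 else m) x"
proof (cases "j < m")
  case True
  then obtain p where m: "m = Suc p" and "j \<le> p"
    by (cases m) auto
  from \<open>j \<le> p\<close> have "(\<Sum>k<Suc p. simplical_face j x k) = (\<Sum>k<p. x k)"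
  proof (induction p rule: dec_induct)
    case base
    have "(\<Sum>k<j. simplical_face j x k) = (\<Sum>k<j. x k)"
      by (intro sum.cong) (auto simp: simplical_face_def)
    then show ?case
      by (simp add: simplical_face_def)
  qed (simp add: simplical_face_def)
  then show ?thesis
    using True m by (simp add: simplex_step_def)
next
  case False
  then have "(\<Sum>k<m. simplical_face j x k) = (\<Sum>k<m. x k)"
    by (intro sum.cong) (auto simp: simplical_face_def)
  then show ?thesis
    using False by (simp add: simplex_step_def)
qed

lemma cmap_simplex_I:
  assumes "\<And>k. continuous_map (powertop_real UNIV) euclideanreal (\<lambda>x. f x k)"
    and "\<And>x. x \<in> standard_simplex m \<Longrightarrow> f x \<in> standard_simplex n"
  shows "cmap (simplex_I m) (simplex_I n) f"
  unfolding simplex_I_def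
  using assms by (intro cmap_of_topology)
    (auto simp: continuous_map_in_subtopology continuous_map_componentwise
      intro: continuous_map_from_subtopology)

lemma pts_simplex_I: "pts (simplex_I n) = standard_simplex n"
  by (simp add: simplex_I_def of_topology_def)

lemma simplicial_model_I:
  "simplicial_model simplex_I simplical_face simplex_degeneracy simplex_step Interval_I"
proof
  have proj: "continuous_map (powertop_real UNIV) euclideanreal (\<lambda>x. x k)" for k :: nat
    by (rule continuous_map_product_projection) simp
  show "closure_space (simplex_I n)" for n
    by (simp add: simplex_I_def closure_space_of_topology)
  show "cmap (simplex_I n) (simplex_I (Suc n)) (simplical_face j)" if "j \<le> Suc n" for j n
  proof (rule cmap_simplex_I)
    show "continuous_map (powertop_real UNIV) euclideanreal (\<lambda>x. simplical_face j x k)" for k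
      unfolding simplical_face_def by (auto intro: proj)
    show "simplical_face j x \<in> standard_simplex (Suc n)" if "x \<in> standard_simplex n" for x :: "nat \<Rightarrow> real"
      using that \<open>j \<le> Suc n\<close> by (intro simplical_face_in_standard_simplex) auto
  qed
  show "cmap (simplex_I (Suc n)) (simplex_I n) (simplex_degeneracy i)" if "i \<le> n" for i n
  proof (rule cmap_simplex_I)
    show "continuous_map (powertop_real UNIV) euclideanreal (\<lambda>x. simplex_degeneracy i x k)" for k
      unfolding simplex_degeneracy_def by (auto intro: proj continuous_map_add)
  qed (rule simplex_degeneracy_in_standard_simplex[OF that])
  show "cmap (simplex_I n) (interval Interval_I) (simplex_step m)" for m n
  proof -
    have "continuous_map (powertop_real UNIV) euclideanreal (simplex_step m)"
      unfolding simplex_step_def by (intro continuous_map_diff continuous_map_sum proj) auto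
    then show ?thesis
      unfolding simplex_I_def interval.simps using simplex_step_bounds
      by (intro cmap_of_topology)
        (auto simp: continuous_map_in_subtopology intro: continuous_map_from_subtopology)
  qed
  fix x n assume "x \<in> pts (simplex_I n)"
  then have x: "x \<in> standard_simplex n"
    by (simp add: pts_simplex_I)
  show "simplex_step 0 x = 1"
    by (simp add: simplex_step_def)
  show "simplex_step (Suc n) x = 0"
    using x by (simp add: simplex_step_def standard_simplex_def lessThan_Suc_atMost)
  show "simplex_degeneracy i (simplical_face i x) = x"
    "simplex_degeneracy i (simplical_face (Suc i) x) = x" for i
    by (auto simp: simplex_degeneracy_def simplical_face_def fun_eq_iff)
  show "simplex_degeneracy i (simplical_face j x) = simplical_face j (simplex_degeneracy (i - 1) x)"
    if "j < i" for i j
    using that by (auto simp: simplex_degeneracy_def simplical_face_def fun_eq_iff)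
  show "simplex_degeneracy i (simplical_face j x) = simplical_face (j - 1) (simplex_degeneracy i x)"
    if "Suc i < j" for i j
    using that by (auto simp: simplex_degeneracy_def simplical_face_def fun_eq_iff)
qed (simp_all add: simplex_step_face)

section \<open>Singular cubes\<close>

lemma closure_space_cube: "closure_space (cube J T n)"
proof (induction n)
  case (Suc n)
  show ?case
    unfolding cube.simps
    by (intro closure_space_transport closure_space_tensor Suc closure_space_interval)
      (auto simp: inj_on_def)
qed (simp add: closure_space_indiscrete_space)

lemma cmap_append:
  "cmap (tensor T (cube J T n) (interval J)) (cube J T (Suc n)) (\<lambda>(xs, t). xs @ [t])"
  unfolding cube.simps
  by (intro cmap_into_transport closure_space_tensor closure_space_cube closure_space_interval)

lemma insert_coord_end: "length xs = n \<Longrightarrow> insert_coord (Suc n) t xs = xs @ [t]"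
  by (simp add: insert_coord_def)

lemma insert_coord_append:
  "i \<in> {1..Suc (length xs)} \<Longrightarrow> insert_coord i t (xs @ [u]) = insert_coord i t xs @ [u]"
  by (auto simp: insert_coord_def)

text \<open>Follows the recursion of \<open>cube\<close>: insertion at the end is a slice followed
  by appending, and any earlier insertion acts on the lower cube times the identity on the last
  coordinate. Both kinds of maps are continuous for either product.\<close>

lemma cmap_insert_coord:
  assumes "i \<in> {1..Suc n}" "u \<in> pts (interval J)"
  shows "cmap (cube J T n) (cube J T (Suc n)) (insert_coord i u)"
  using assms(1)
proof (induction n)
  case 0
  have "cmap (cube J T 0) (cube J T (Suc 0)) (\<lambda>xs. case (xs, u) of (xs, t) \<Rightarrow> xs @ [t])"
    using cmap_slice[OF closure_space_cube closure_space_interval assms(2)] cmap_append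
    by (rule cmap_compose)
  then show ?case
    by (rule cmap_cong[rotated 2])
      (use 0 closure_space_cube in \<open>auto simp: pts_cube insert_coord_def simp del: cube.simps\<close>)
next
  case (Suc n)
  show ?case
  proof (cases "i = Suc (Suc n)")
    case True
    have "cmap (cube J T (Suc n)) (cube J T (Suc (Suc n))) (\<lambda>xs. case (xs, u) of (xs, t) \<Rightarrow> xs @ [t])"
      using cmap_slice[OF closure_space_cube closure_space_interval assms(2)] cmap_append
      by (rule cmap_compose)
    then show ?thesis
      by (rule cmap_cong[rotated 2])
        (use True closure_space_cube in \<open>auto simp: pts_cube insert_coord_end simp del: cube.simps\<close>)
  next
    case False
    then have i: "i \<in> {1..Suc n}"
      using Suc.prems by auto
    let ?P = "tensor T (cube J T n) (interval J)"
    have "cmap ?P (tensor T (cube J T (Suc n)) (interval J)) (map_prod (insert_coord i u) (\<lambda>t. t))"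
      by (intro cmap_map_prod closure_space_cube closure_space_interval cmap_id Suc.IH i)
    then have "cmap ?P (cube J T (Suc (Suc n)))
        (\<lambda>p. case map_prod (insert_coord i u) (\<lambda>t. t) p of (xs, t) \<Rightarrow> xs @ [t])"
      using cmap_append by (rule cmap_compose)
    \<comment> \<open>Rewritten as a function of the appended list, the form in which continuity
      descends along \<open>transport\<close>.\<close>
    then have "cmap ?P (cube J T (Suc (Suc n))) (\<lambda>p. insert_coord i u (case p of (xs, t) \<Rightarrow> xs @ [t]))"
      by (rule cmap_cong[rotated 2])
        (use i in \<open>auto simp: pts_tensor pts_cube insert_coord_append closure_space_tensor
          closure_space_cube closure_space_interval simp del: cube.simps\<close>)
    then show ?thesis
      unfolding cube.simps(2)[of J T n] by (rule cmap_from_transport)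
  qed
qed

lemma insert_coord_in_pts:
  assumes "xs \<in> pts (cube J T n)" "i \<in> {1..Suc n}" "u \<in> pts (interval J)"
  shows "insert_coord i u xs \<in> pts (cube J T (Suc n))"
  using cmap_in_pts[OF cmap_insert_coord assms(1)] assms(2,3) .

text \<open>Coordinates count from 1 and list positions from 0: \<open>l - 1 - 1\<close> is the
  position of coordinate l - 1 of xs, which the insertion moved up to l.\<close>

lemma nth_insert_coord:
  assumes "j \<in> {1..Suc (length xs)}" "l \<in> {1..Suc (length xs)}"
  shows "insert_coord j u xs ! (l - 1) =
    (if l < j then xs ! (l - 1) else if l = j then u else xs ! (l - 1 - 1))"
  using assms by (auto simp: insert_coord_def nth_append nth_Cons' min_def numeral_2_eq_2)

section \<open>Degenerate cubes and their faces\<close>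

text \<open>The condition inside \<open>degenerate_cubes\<close> with the direction i exposed, since
  the behavior of a face depends on whether it is taken in direction i.\<close>

definition constant_in_coord :: "interval_kind \<Rightarrow> product_kind \<Rightarrow> nat \<Rightarrow> nat \<Rightarrow> (real list \<Rightarrow> 'a) \<Rightarrow> bool"
  where "constant_in_coord J T n i \<sigma> \<longleftrightarrow> (\<forall>xs \<in> pts (cube J T n). \<forall>ys \<in> pts (cube J T n).
    (\<forall>j\<in>{1..n}. j \<noteq> i \<longrightarrow> xs ! (j - 1) = ys ! (j - 1)) \<longrightarrow> \<sigma> xs = \<sigma> ys)"

lemma degenerate_cubes_iff:
  "\<sigma> \<in> degenerate_cubes J T n X \<longleftrightarrow>
    \<sigma> \<in> cmaps (cube J T n) X \<and> (\<exists>i\<in>{1..n}. constant_in_coord J T n i \<sigma>)"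
  by (simp add: degenerate_cubes_def constant_in_coord_def)

lemma constant_in_coordD:
  assumes "constant_in_coord J T n i \<sigma>" "xs \<in> pts (cube J T n)" "ys \<in> pts (cube J T n)"
    and "\<And>j. j \<in> {1..n} \<Longrightarrow> j \<noteq> i \<Longrightarrow> xs ! (j - 1) = ys ! (j - 1)"
  shows "\<sigma> xs = \<sigma> ys"
  using assms unfolding constant_in_coord_def by blast

definition cube_face :: "interval_kind \<Rightarrow> product_kind \<Rightarrow> nat \<Rightarrow> nat \<Rightarrow> real \<Rightarrow> (real list \<Rightarrow> 'a) \<Rightarrow> real list \<Rightarrow> 'a"
  where "cube_face J T n i u \<sigma> = restrict (\<sigma> \<circ> insert_coord i u) (pts (cube J T n))"

lemma cube_face_in_cmaps:
  assumes "\<sigma> \<in> cmaps (cube J T (Suc n)) X" "i \<in> {1..Suc n}" "u \<in> pts (interval J)"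
  shows "cube_face J T n i u \<sigma> \<in> cmaps (cube J T n) X"
  using assms unfolding cube_face_def comp_def
  by (intro cmap_restrict cmap_compose[OF cmap_insert_coord] closure_space_cube)
    (auto simp: cmaps_def simp del: cube.simps)

text \<open>The two inserted points differ in coordinate i alone. In the boundary of a degenerate
  cube this pair of faces therefore cancels.\<close>

lemma cube_face_constant_same:
  assumes "constant_in_coord J T (Suc n) i \<sigma>" "i \<in> {1..Suc n}"
  shows "cube_face J T n i 0 \<sigma> = cube_face J T n i 1 \<sigma>"
  unfolding cube_face_def
proof (rule restrict_ext, unfold comp_def)
  fix xs assume xs: "xs \<in> pts (cube J T n)"
  then have "length xs = n"
    by (simp add: pts_cube)
  then show "\<sigma> (insert_coord i 0 xs) = \<sigma> (insert_coord i 1 xs)"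
    using assms(2) by (intro constant_in_coordD[OF assms(1)])
      (auto simp: insert_coord_in_pts[OF xs] interval_endpoints nth_insert_coord[simplified] simp del: cube.simps)
qed

lemma cube_face_degenerate:
  assumes \<sigma>: "\<sigma> \<in> cmaps (cube J T (Suc n)) X" "constant_in_coord J T (Suc n) i \<sigma>"
    and i: "i \<in> {1..Suc n}" and j: "j \<in> {1..Suc n}" and "i \<noteq> j" and u: "u \<in> pts (interval J)"
  shows "cube_face J T n j u \<sigma> \<in> degenerate_cubes J T n X"
  unfolding degenerate_cubes_iff
proof (intro conjI bexI)
  \<comment> \<open>Dropping coordinate j leaves coordinate i in place if it comes earlier and moves
    it down by one otherwise.\<close>
  let ?k = "if i < j then i else i - 1"
  show "constant_in_coord J T n ?k (cube_face J T n j u \<sigma>)"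
    unfolding constant_in_coord_def
  proof (intro ballI impI)
    fix xs ys assume xs: "xs \<in> pts (cube J T n)" and ys: "ys \<in> pts (cube J T n)"
      and eq: "\<forall>l\<in>{1..n}. l \<noteq> ?k \<longrightarrow> xs ! (l - 1) = ys ! (l - 1)"
    have len: "length xs = n" "length ys = n"
      using xs ys by (simp_all add: pts_cube)
    have "\<sigma> (insert_coord j u xs) = \<sigma> (insert_coord j u ys)"
    proof (rule constant_in_coordD[OF \<sigma>(2)])
      fix l assume l: "l \<in> {1..Suc n}" "l \<noteq> i"
      have "xs ! (l - 1) = ys ! (l - 1)" if "l < j"
      proof -
        have "l \<noteq> ?k"
          using that l \<open>i \<noteq> j\<close> by (cases "i < j") auto
        then show ?thesis
          using eq that l j by auto
      qed
      moreover have "xs ! (l - 1 - 1) = ys ! (l - 1 - 1)" if "l > j"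
      proof -
        have "l - 1 \<noteq> ?k"
          using that l \<open>i \<noteq> j\<close> by (cases "i < j") auto
        moreover have "l - 1 \<in> {1..n}"
          using that l j by auto
        ultimately show ?thesis
          using eq by blast
      qed
      ultimately show "insert_coord j u xs ! (l - 1) = insert_coord j u ys ! (l - 1)"
        using nth_insert_coord[of j xs l u] nth_insert_coord[of j ys l u] j l len by auto
    qed (use xs ys j u in \<open>auto intro!: insert_coord_in_pts simp del: cube.simps\<close>)
    then show "cube_face J T n j u \<sigma> xs = cube_face J T n j u \<sigma> ys"
      using xs ys by (simp add: cube_face_def)
  qed
  show "?k \<in> {1..n}"
    using i j \<open>i \<noteq> j\<close> by auto
qed (intro cube_face_in_cmaps assms)

lemma frag_cmul_diff_distrib2: "frag_cmul k (a - b) = frag_cmul k a - frag_cmul k b"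
  by (rule poly_mapping_eqI) (simp add: lookup_minus right_diff_distrib)

lemma cube_boundary_of:
  "cube_boundary J T (Suc n) (frag_of \<sigma>) = (\<Sum>i\<in>{1..Suc n}. frag_cmul ((-1) ^ i)
    (frag_of (cube_face J T n i 0 \<sigma>) - frag_of (cube_face J T n i 1 \<sigma>)))"
  by (simp add: cube_boundary_def cube_face_def del: cube.simps sum.cl_ivl_Suc)

lemma cube_boundary_0: "cube_boundary J T n 0 = 0"
  by (simp add: cube_boundary_def)

lemma cube_boundary_diff:
  "cube_boundary J T n (a - b) = cube_boundary J T n a - cube_boundary J T n b"
  by (simp add: cube_boundary_def frag_extend_diff)

lemma hom_cube_boundary:
  "cube_boundary J T (Suc n) \<in> hom (cube_chains J T X (Suc n)) (cube_chains J T X n)"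
  unfolding cube_boundary_def cube_chains_def
proof (intro hom_frag_extend keys_sum_cmul)
  fix \<sigma> i assume "\<sigma> \<in> cmaps (cube J T (Suc n)) X" "i \<in> {1..Suc n}"
  then have "cube_face J T n i 0 \<sigma> \<in> cmaps (cube J T n) X" "cube_face J T n i 1 \<sigma> \<in> cmaps (cube J T n) X"
    by (auto intro!: cube_face_in_cmaps interval_endpoints simp del: cube.simps)
  then show "Poly_Mapping.keys (frag_of (restrict (\<sigma> \<circ> insert_coord i 0) (pts (cube J T (Suc n - 1)))) -
      frag_of (restrict (\<sigma> \<circ> insert_coord i 1) (pts (cube J T (Suc n - 1))))) \<subseteq> cmaps (cube J T n) X"
    by (intro subset_trans[OF keys_diff]) (auto simp: cube_face_def)
qed

section \<open>The subgroup of degenerate chains and the maps preserving it\<close>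

lemma comm_group_cube_chains: "comm_group (cube_chains J T X n)"
  by (simp add: cube_chains_def abelian_free_Abelian_group)

lemma subgroup_degenerate_chains: "subgroup (degenerate_chains J T X n) (cube_chains J T X n)"
  unfolding degenerate_chains_def
  by (intro group.generate_is_subgroup comm_group.axioms(2) comm_group_cube_chains)
    (auto simp: cube_chains_def degenerate_cubes_def)

lemma normal_degenerate_chains: "degenerate_chains J T X n \<lhd> cube_chains J T X n"
  by (intro comm_group.subgroup_imp_normal comm_group_cube_chains subgroup_degenerate_chains)

lemma degenerate_chains_of: "\<sigma> \<in> degenerate_cubes J T n X \<Longrightarrow> frag_of \<sigma> \<in> degenerate_chains J T X n"
  unfolding degenerate_chains_def by (intro generate.incl) auto

lemma degenerate_chains_0: "0 \<in> degenerate_chains J T X n"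
  using subgroup.one_closed[OF subgroup_degenerate_chains] by (simp add: cube_chains_def)

lemma degenerate_chains_add:
  "a \<in> degenerate_chains J T X n \<Longrightarrow> b \<in> degenerate_chains J T X n \<Longrightarrow> a + b \<in> degenerate_chains J T X n"
  using subgroup.m_closed[OF subgroup_degenerate_chains, of a J T X n b] by (simp add: cube_chains_def)

lemma degenerate_chains_minus:
  assumes "a \<in> degenerate_chains J T X n"
  shows "- a \<in> degenerate_chains J T X n"
  using subgroup.m_inv_closed[OF subgroup_degenerate_chains assms]
    subgroup.mem_carrier[OF subgroup_degenerate_chains assms]
  by (simp add: cube_chains_def)

lemma degenerate_chains_diff:
  "a \<in> degenerate_chains J T X n \<Longrightarrow> b \<in> degenerate_chains J T X n \<Longrightarrow> a - b \<in> degenerate_chains J T X n"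
  using degenerate_chains_add[OF _ degenerate_chains_minus] by fastforce

lemma degenerate_chains_sign:
  "a \<in> degenerate_chains J T X n \<Longrightarrow> frag_cmul ((-1) ^ k) a \<in> degenerate_chains J T X n"
  by (cases "even k") (simp_all add: degenerate_chains_minus)

lemma degenerate_chains_sum:
  "(\<And>i. i \<in> I \<Longrightarrow> u i \<in> degenerate_chains J T X n) \<Longrightarrow> sum u I \<in> degenerate_chains J T X n"
  by (induction I rule: infinite_finite_induct) (auto simp: degenerate_chains_0 degenerate_chains_add)

text \<open>The image of a generated subgroup is generated by the image, so only degenerate cubes
  need checking. Applied to boundary, push-forward and prism.\<close>

lemma image_degenerate_chains:
  assumes "k \<in> hom (cube_chains J T X n) (cube_chains J T Y m)"
    and "\<And>\<sigma>. \<sigma> \<in> degenerate_cubes J T n X \<Longrightarrow> k (frag_of \<sigma>) \<in> degenerate_chains J T Y m"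
  shows "k ` degenerate_chains J T X n \<subseteq> degenerate_chains J T Y m"
proof -
  interpret group_hom "cube_chains J T X n" "cube_chains J T Y m" k
    by (intro group_hom.intro group_hom_axioms.intro comm_group.axioms(2) comm_group_cube_chains assms)
  have sub: "frag_of ` degenerate_cubes J T n X \<subseteq> carrier (cube_chains J T X n)"
    by (auto simp: cube_chains_def degenerate_cubes_def)
  have "k ` degenerate_chains J T X n = generate (cube_chains J T Y m) (k ` frag_of ` degenerate_cubes J T n X)"
    unfolding degenerate_chains_def by (rule generate_img[OF sub, symmetric])
  also have "\<dots> \<subseteq> degenerate_chains J T Y m"
    using assms(2) by (intro H.generate_subgroup_incl subgroup_degenerate_chains) auto
  finally show ?thesis .
qed

text \<open>For a cube constant in direction i, the two faces in that direction cancel and all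
  others are again degenerate.\<close>

lemma cube_boundary_degenerate:
  "cube_boundary J T (Suc n) ` degenerate_chains J T X (Suc n) \<subseteq> degenerate_chains J T X n"
proof (rule image_degenerate_chains[OF hom_cube_boundary])
  fix \<sigma> assume "\<sigma> \<in> degenerate_cubes J T (Suc n) X"
  then obtain i where \<sigma>: "\<sigma> \<in> cmaps (cube J T (Suc n)) X" "constant_in_coord J T (Suc n) i \<sigma>"
    and i: "i \<in> {1..Suc n}"
    by (auto simp: degenerate_cubes_iff)
  have "frag_of (cube_face J T n j 0 \<sigma>) - frag_of (cube_face J T n j 1 \<sigma>) \<in> degenerate_chains J T X n"
    if j: "j \<in> {1..Suc n}" for j
  proof (cases "j = i")
    case True
    then show ?thesis
      using cube_face_constant_same[OF \<sigma>(2) i] by (simp add: degenerate_chains_0)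
  next
    case False
    then show ?thesis
      using cube_face_degenerate[OF \<sigma> i j]
      by (intro degenerate_chains_diff degenerate_chains_of) (auto simp: interval_endpoints)
  qed
  then show "cube_boundary J T (Suc n) (frag_of \<sigma>) \<in> degenerate_chains J T X n"
    unfolding cube_boundary_of by (intro degenerate_chains_sum degenerate_chains_sign)
qed

lemma hom_push_forward_cube:
  "cmap X Y f \<Longrightarrow> push_forward (cube J T n) f \<in> hom (cube_chains J T X n) (cube_chains J T Y n)"
  unfolding cube_chains_def by (intro hom_push_forward closure_space_cube)

lemma push_forward_degenerate:
  assumes f: "cmap X Y f"
  shows "push_forward (cube J T n) f ` degenerate_chains J T X n \<subseteq> degenerate_chains J T Y n"
proof (rule image_degenerate_chains[OF hom_push_forward_cube[OF f]])
  fix \<sigma> assume "\<sigma> \<in> degenerate_cubes J T n X"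
  then obtain i where \<sigma>: "\<sigma> \<in> cmaps (cube J T n) X" "constant_in_coord J T n i \<sigma>" and i: "i \<in> {1..n}"
    by (auto simp: degenerate_cubes_iff)
  from \<sigma>(1) have "restrict (\<lambda>x. f (\<sigma> x)) (pts (cube J T n)) \<in> cmaps (cube J T n) Y"
    by (intro cmap_restrict closure_space_cube cmap_compose[OF _ f]) (simp add: cmaps_def)
  moreover have "constant_in_coord J T n i (restrict (\<lambda>x. f (\<sigma> x)) (pts (cube J T n)))"
    unfolding constant_in_coord_def
  proof (intro ballI impI)
    fix xs ys assume xs: "xs \<in> pts (cube J T n)" and ys: "ys \<in> pts (cube J T n)"
      and eq: "\<forall>j\<in>{1..n}. j \<noteq> i \<longrightarrow> xs ! (j - 1) = ys ! (j - 1)"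
    have "\<sigma> xs = \<sigma> ys"
      using eq by (intro constant_in_coordD[OF \<sigma>(2) xs ys]) auto
    then show "restrict (\<lambda>x. f (\<sigma> x)) (pts (cube J T n)) xs = restrict (\<lambda>x. f (\<sigma> x)) (pts (cube J T n)) ys"
      using xs ys by simp
  qed
  ultimately have "restrict (f \<circ> \<sigma>) (pts (cube J T n)) \<in> degenerate_cubes J T n Y"
    using i unfolding degenerate_cubes_iff comp_def by blast
  then show "push_forward (cube J T n) f (frag_of \<sigma>) \<in> degenerate_chains J T Y n"
    unfolding push_forward_of by (rule degenerate_chains_of)
qed

lemma cube_boundary_push_forward:
  "cube_boundary J T (Suc n) (push_forward (cube J T (Suc n)) f c) =
    push_forward (cube J T n) f (cube_boundary J T (Suc n) c)"
proof (induction c rule: frag_induction[OF subset_UNIV])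
  case (2 \<sigma>)
  have "cube_face J T n i u (restrict (f \<circ> \<sigma>) (pts (cube J T (Suc n)))) =
      restrict (f \<circ> cube_face J T n i u \<sigma>) (pts (cube J T n))"
    if "i \<in> {1..Suc n}" "u \<in> pts (interval J)" for i u
    using insert_coord_in_pts that by (auto simp: fun_eq_iff cube_face_def simp del: cube.simps)
  then show ?case
    by (auto simp: push_forward_of cube_boundary_of push_forward_sum push_forward_diff interval_endpoints
        simp del: sum.cl_ivl_Suc cube.simps intro!: sum.cong)
qed (simp_all add: push_forward_0 cube_boundary_0 push_forward_diff cube_boundary_diff
    del: cube.simps)

text \<open>The homotopy parameter becomes the last coordinate, so the faces of \<open>cube_prism J T H n \<sigma>\<close>
  in the first \<open>n\<close> directions are prisms over the faces of \<open>\<sigma>\<close>.\<close>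

definition cube_prism :: "interval_kind \<Rightarrow> product_kind \<Rightarrow> ('a \<times> real \<Rightarrow> 'b) \<Rightarrow> nat \<Rightarrow>
    (real list \<Rightarrow> 'a) \<Rightarrow> real list \<Rightarrow> 'b"
  where "cube_prism J T H n \<sigma> = restrict (\<lambda>zs. H (\<sigma> (butlast zs), last zs)) (pts (cube J T (Suc n)))"

text \<open>The sign compensates the boundary, where the two faces in the last direction n + 1 occur
  as (-1)^(n+1) times (f - g); after multiplication by (-1)^n this is g - f.\<close>

definition cube_prism_chain :: "interval_kind \<Rightarrow> product_kind \<Rightarrow> ('a \<times> real \<Rightarrow> 'b) \<Rightarrow> nat \<Rightarrow>
    ((real list \<Rightarrow> 'a) \<Rightarrow>\<^sub>0 int) \<Rightarrow> ((real list \<Rightarrow> 'b) \<Rightarrow>\<^sub>0 int)"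
  where "cube_prism_chain J T H n = frag_extend (\<lambda>\<sigma>. frag_cmul ((-1) ^ n) (frag_of (cube_prism J T H n \<sigma>)))"

section \<open>Prisms over cubes\<close>

lemma butlast_in_pts: "zs \<in> pts (cube J T (Suc n)) \<Longrightarrow> butlast zs \<in> pts (cube J T n)"
  by (auto simp: pts_cube simp del: cube.simps dest: in_set_butlastD)

lemma cube_prism_in_cmaps:
  assumes X: "closure_space X" and H: "cmap (tensor T X (interval J)) Y H"
    and \<sigma>: "\<sigma> \<in> cmaps (cube J T n) X"
  shows "cube_prism J T H n \<sigma> \<in> cmaps (cube J T (Suc n)) Y"
  unfolding cube_prism_def
proof (intro cmap_restrict closure_space_cube, unfold cube.simps(2), rule cmap_from_transport)
  let ?P = "tensor T (cube J T n) (interval J)"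
  have "cmap ?P (tensor T X (interval J)) (map_prod \<sigma> (\<lambda>t. t))"
    using \<sigma> by (intro cmap_map_prod closure_space_cube closure_space_interval cmap_id X)
      (simp add: cmaps_def)
  then have "cmap ?P Y (\<lambda>p. H (map_prod \<sigma> (\<lambda>t. t) p))"
    using H by (rule cmap_compose)
  \<comment> \<open>On pairs, \<open>butlast\<close> and \<open>last\<close> undo the appending, so
    the prism becomes H after \<sigma> \<otimes> id.\<close>
  then show "cmap ?P Y (\<lambda>p. H (\<sigma> (butlast (case p of (xs, t) \<Rightarrow> xs @ [t])), last (case p of (xs, t) \<Rightarrow> xs @ [t])))"
    by (rule cmap_cong[rotated 2])
      (auto simp: closure_space_tensor closure_space_cube closure_space_interval)
qed

lemma hom_cube_prism_chain:
  assumes "closure_space X" "cmap (tensor T X (interval J)) Y H"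
  shows "cube_prism_chain J T H n \<in> hom (cube_chains J T X n) (cube_chains J T Y (Suc n))"
  unfolding cube_chains_def cube_prism_chain_def
  using cube_prism_in_cmaps[OF assms] by (intro hom_frag_extend) auto

lemma cube_prism_chain_degenerate:
  assumes X: "closure_space X" and H: "cmap (tensor T X (interval J)) Y H"
  shows "cube_prism_chain J T H n ` degenerate_chains J T X n \<subseteq> degenerate_chains J T Y (Suc n)"
proof (rule image_degenerate_chains[OF hom_cube_prism_chain[OF assms]])
  fix \<sigma> assume "\<sigma> \<in> degenerate_cubes J T n X"
  then obtain i where \<sigma>: "\<sigma> \<in> cmaps (cube J T n) X" "constant_in_coord J T n i \<sigma>" and i: "i \<in> {1..n}"
    by (auto simp: degenerate_cubes_iff)
  have "constant_in_coord J T (Suc n) i (cube_prism J T H n \<sigma>)"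
    unfolding constant_in_coord_def
  proof (intro ballI impI)
    fix xs ys assume xs: "xs \<in> pts (cube J T (Suc n))" and ys: "ys \<in> pts (cube J T (Suc n))"
      and eq: "\<forall>j\<in>{1..Suc n}. j \<noteq> i \<longrightarrow> xs ! (j - 1) = ys ! (j - 1)"
    have len: "length xs = Suc n" "length ys = Suc n"
      using xs ys by (simp_all add: pts_cube del: cube.simps)
    \<comment> \<open>The last entry is coordinate n + 1, which differs from i because i \<le>
      n.\<close>
    then have "last xs = last ys"
      using eq[rule_format, of "Suc n"] i last_conv_nth[of xs] last_conv_nth[of ys] by fastforce
    moreover have "\<sigma> (butlast xs) = \<sigma> (butlast ys)"
      using eq len by (intro constant_in_coordD[OF \<sigma>(2)] butlast_in_pts xs ys)
        (auto simp: nth_butlast)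
    ultimately show "cube_prism J T H n \<sigma> xs = cube_prism J T H n \<sigma> ys"
      using xs ys by (simp add: cube_prism_def del: cube.simps)
  qed
  then have "cube_prism J T H n \<sigma> \<in> degenerate_cubes J T (Suc n) Y"
    using i cube_prism_in_cmaps[OF assms \<sigma>(1)] unfolding degenerate_cubes_iff by force
  then show "cube_prism_chain J T H n (frag_of \<sigma>) \<in> degenerate_chains J T Y (Suc n)"
    by (simp add: cube_prism_chain_def degenerate_chains_sign degenerate_chains_of)
qed

text \<open>An insertion at place at most n + 1 happens before the last entry, so it commutes with
  splitting off the homotopy parameter.\<close>

lemma cube_face_prism:
  assumes "i \<in> {1..Suc n}" "u \<in> pts (interval J)"
  shows "cube_face J T (Suc n) i u (cube_prism J T H (Suc n) \<sigma>) = cube_prism J T H n (cube_face J T n i u \<sigma>)"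
proof
  fix zs
  show "cube_face J T (Suc n) i u (cube_prism J T H (Suc n) \<sigma>) zs = cube_prism J T H n (cube_face J T n i u \<sigma>) zs"
  proof (cases "zs \<in> pts (cube J T (Suc n))")
    case True
    then obtain xs t where zs: "zs = xs @ [t]" "length xs = n"
      by (auto simp: pts_cube length_Suc_conv_rev simp del: cube.simps)
    moreover have "xs \<in> pts (cube J T n)"
      using butlast_in_pts[OF True] zs by simp
    moreover have "insert_coord i u zs \<in> pts (cube J T (Suc (Suc n)))"
      using True assms by (intro insert_coord_in_pts) auto
    ultimately show ?thesis
      using True assms insert_coord_append[of i xs u t]
      by (simp add: cube_face_def cube_prism_def del: cube.simps)
  qed (simp add: cube_face_def cube_prism_def del: cube.simps)
qed

lemma cube_face_prism_end:
  assumes "u \<in> pts (interval J)" "\<sigma> \<in> cmaps (cube J T n) X" "\<And>x. x \<in> pts X \<Longrightarrow> H (x, u) = f x"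
  shows "cube_face J T n (Suc n) u (cube_prism J T H n \<sigma>) = restrict (f \<circ> \<sigma>) (pts (cube J T n))"
  unfolding cube_face_def
proof (rule restrict_ext)
  fix zs assume zs: "zs \<in> pts (cube J T n)"
  then have "insert_coord (Suc n) u zs \<in> pts (cube J T (Suc n))"
    using assms(1) by (intro insert_coord_in_pts) auto
  moreover have "length zs = n" "\<sigma> zs \<in> pts X"
    using zs assms(2) by (auto simp: pts_cube cmaps_def cmap_def)
  ultimately show "(cube_prism J T H n \<sigma> \<circ> insert_coord (Suc n) u) zs = (f \<circ> \<sigma>) zs"
    using assms(3) by (simp add: cube_prism_def insert_coord_end del: cube.simps)
qed

lemma cube_prism_chain_homotopy:
  assumes H: "\<And>x. x \<in> pts X \<Longrightarrow> H (x, 0) = f x \<and> H (x, 1) = g x"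
    and c: "c \<in> carrier (cube_chains J T X n)"
  shows "push_forward (cube J T n) g c =
    (if n = 0 then 0 else cube_prism_chain J T H (n - 1) (cube_boundary J T n c)) +
    (cube_boundary J T (Suc n) (cube_prism_chain J T H n c) + push_forward (cube J T n) f c)"
proof -
  have "Poly_Mapping.keys c \<subseteq> cmaps (cube J T n) X"
    using c by (simp add: cube_chains_def)
  then show ?thesis
  proof (induction c rule: frag_induction)
    case (one \<sigma>)
    let ?\<tau> = "cube_prism J T H n \<sigma>"
    let ?b = "\<Sum>i\<in>{1..n}. frag_cmul ((-1) ^ n * (-1) ^ i)
      (frag_of (cube_face J T n i 0 ?\<tau>) - frag_of (cube_face J T n i 1 ?\<tau>))"
    have ends: "frag_of (cube_face J T n (Suc n) 0 ?\<tau>) = push_forward (cube J T n) f (frag_of \<sigma>)"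
      "frag_of (cube_face J T n (Suc n) 1 ?\<tau>) = push_forward (cube J T n) g (frag_of \<sigma>)"
      using cube_face_prism_end[OF _ one(1), of _ H] H
      by (simp_all add: push_forward_of interval_endpoints)
    have "cube_boundary J T (Suc n) (cube_prism_chain J T H n (frag_of \<sigma>)) =
        frag_cmul ((-1) ^ n) (cube_boundary J T (Suc n) (frag_of ?\<tau>))"
      by (simp add: cube_prism_chain_def cube_boundary_def frag_extend_cmul del: cube.simps sum.cl_ivl_Suc)
    \<comment> \<open>Direction n + 1 is split off: it carries the ends of the homotopy, while
      \<open>?b\<close> collects the directions of \<sigma>.\<close>
    also have "\<dots> = ?b + frag_cmul ((-1) ^ n * (-1) ^ Suc n)
        (push_forward (cube J T n) f (frag_of \<sigma>) - push_forward (cube J T n) g (frag_of \<sigma>))"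
      by (simp add: cube_boundary_of frag_cmul_distrib2 frag_cmul_sum ends del: power_Suc)
    also have "\<dots> = ?b + push_forward (cube J T n) g (frag_of \<sigma>) - push_forward (cube J T n) f (frag_of \<sigma>)"
      by (simp flip: power_add)
    finally have 1: "cube_boundary J T (Suc n) (cube_prism_chain J T H n (frag_of \<sigma>)) = \<dots>" .
    show ?case
    proof (cases n)
      case 0
      then show ?thesis
        using 1 by simp
    next
      case (Suc m)
      \<comment> \<open>The faces in \<open>?b\<close> are prisms over faces of \<sigma>. The prism
        operator in degree m has sign (-1)^m, whereas \<open>?b\<close> carries (-1)^n with n = m +
        1, hence the minus.\<close>
      have "cube_prism_chain J T H m (cube_boundary J T (Suc m) (frag_of \<sigma>)) = - ?b"
        by (simp add: cube_prism_chain_def cube_boundary_of frag_extend_sum frag_extend_cmul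
            frag_extend_diff Suc cube_face_prism interval_endpoints frag_cmul_sum sum_negf[symmetric]
            frag_cmul_diff_distrib2 mult.commute del: sum.cl_ivl_Suc)
          (simp flip: minus_frag_cmul)
      then show ?thesis
        using 1 Suc by simp
    qed
  qed (simp_all add: push_forward_0 cube_boundary_0 push_forward_diff cube_boundary_diff
      cube_prism_chain_def frag_extend_diff)
qed

section \<open>Passage to the quotient by degenerate chains\<close>

lemma hom_quot_map:
  assumes G: "group G" and H: "group H" and h: "h \<in> hom G H"
    and N: "N \<lhd> G" and M: "M \<lhd> H" and sub: "h ` N \<subseteq> M"
  shows "quot_map H M h \<in> hom (G Mod N) (H Mod M)"
proof (rule homI)
  interpret N: normal N G by fact
  interpret M: normal M H by fact
  have coset: "quot_map H M h (N #>\<^bsub>G\<^esub> x) = M #>\<^bsub>H\<^esub> h x" if "x \<in> carrier G" for x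
    using G H h that N.subgroup_axioms M sub by (rule quot_map_coset)
  fix K assume "K \<in> carrier (G Mod N)"
  then obtain x where x: "x \<in> carrier G" "K = N #>\<^bsub>G\<^esub> x"
    by (auto simp: FactGroup_def RCOSETS_def)
  then show "quot_map H M h K \<in> carrier (H Mod M)"
    using hom_in_carrier[OF h] by (auto simp: coset FactGroup_def RCOSETS_def)
  fix L assume "L \<in> carrier (G Mod N)"
  then obtain y where y: "y \<in> carrier G" "L = N #>\<^bsub>G\<^esub> y"
    by (auto simp: FactGroup_def RCOSETS_def)
  show "quot_map H M h (K \<otimes>\<^bsub>G Mod N\<^esub> L) = quot_map H M h K \<otimes>\<^bsub>H Mod M\<^esub> quot_map H M h L"
    using x y hom_in_carrier[OF h]
    by (simp add: FactGroup_def N.rcos_sum M.rcos_sum coset hom_mult[OF h])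
qed

text \<open>Every element of the quotient complex is the coset of a chain, and the induced maps act
  on representatives, so the chain homotopy identity descends.\<close>

lemma cubical_pullback_eq:
  assumes G: "comm_group G" and X: "closure_space X"
    and fg: "one_step_homotopic J T X Y f g"
  shows "cubical_pullback J T X Y G n f = cubical_pullback J T X Y G n g"
proof -
  obtain H where H: "cmap (tensor T X (interval J)) Y H"
      "\<And>x. x \<in> pts X \<Longrightarrow> H (x, 0) = f x \<and> H (x, 1) = g x"
    and f: "cmap X Y f" and g: "cmap X Y g"
    using fg unfolding one_step_homotopic_def by blast
  have grp: "group (cube_chains J T Z m)" for Z :: "'z cspace" and m
    using comm_group_cube_chains by (rule comm_group.axioms(2))
  note coset = quot_map_coset[OF grp grp _ _ subgroup_degenerate_chains normal_degenerate_chains]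
  note hom_quot = hom_quot_map[OF grp grp _ normal_degenerate_chains normal_degenerate_chains]
  let ?DX = "degenerate_chains J T X" and ?DY = "degenerate_chains J T Y"
  let ?QX = "cube_chains J T X" and ?QY = "cube_chains J T Y"
  let ?C = "cubical_complex J T X" and ?D = "cubical_complex J T Y"
  let ?F = "\<lambda>h m. quot_map (?QY m) (?DY m) (push_forward (cube J T m) h)"
  let ?P = "\<lambda>m. quot_map (?QY (Suc m)) (?DY (Suc m)) (cube_prism_chain J T H m)"
  \<comment> \<open>These rules, with \<open>mult\<close>, move each induced operation inside the
    coset until both sides are cosets of single chains.\<close>
  have coset_F: "?F h m (?DX m #>\<^bsub>?QX m\<^esub> c) = ?DY m #>\<^bsub>?QY m\<^esub> push_forward (cube J T m) h c"
    if "c \<in> carrier (?QX m)" "cmap X Y h" for h m c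
    using that by (intro coset hom_push_forward_cube push_forward_degenerate)
  have coset_P: "?P m (?DX m #>\<^bsub>?QX m\<^esub> c) = ?DY (Suc m) #>\<^bsub>?QY (Suc m)\<^esub> cube_prism_chain J T H m c"
    if "c \<in> carrier (?QX m)" for m c
    using that by (intro coset hom_cube_prism_chain cube_prism_chain_degenerate X H(1))
  have coset_b: "bdry (cubical_complex J T Z) (Suc m) (degenerate_chains J T Z (Suc m) #>\<^bsub>cube_chains J T Z (Suc m)\<^esub> c) =
      degenerate_chains J T Z m #>\<^bsub>cube_chains J T Z m\<^esub> cube_boundary J T (Suc m) c"
    if "c \<in> carrier (cube_chains J T Z (Suc m))" for Z :: "'z cspace" and m c
    using coset[OF hom_cube_boundary that cube_boundary_degenerate]
    by (simp add: cubical_complex_def)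
  have mult: "(?DY m #>\<^bsub>?QY m\<^esub> a) \<otimes>\<^bsub>chains ?D m\<^esub> (?DY m #>\<^bsub>?QY m\<^esub> b) = ?DY m #>\<^bsub>?QY m\<^esub> (a + b)"
    if "a \<in> carrier (?QY m)" "b \<in> carrier (?QY m)" for a b m
    using normal.rcos_sum[OF normal_degenerate_chains that]
    by (simp add: cubical_complex_def FactGroup_def) (simp add: cube_chains_def)
  have add: "a + b \<in> carrier (?QY m)" if "a \<in> carrier (?QY m)" "b \<in> carrier (?QY m)" for a b m
    using monoid.m_closed[OF group.is_monoid[OF grp] that] by (simp add: cube_chains_def)
  have carrierE: "\<exists>c\<in>carrier (?QX m). K = ?DX m #>\<^bsub>?QX m\<^esub> c" if "K \<in> carrier (chains ?C m)" for K m
    using that by (auto simp: cubical_complex_def FactGroup_def RCOSETS_def)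
  note closed = hom_in_carrier[OF hom_push_forward_cube[OF f]] hom_in_carrier[OF hom_push_forward_cube[OF g]]
    hom_in_carrier[OF hom_cube_boundary] hom_in_carrier[OF hom_cube_prism_chain[OF X H(1)]]
  have chain: "bdry ?D (Suc m) (?F h (Suc m) K) = ?F h m (bdry ?C (Suc m) K)"
    if K: "K \<in> carrier (chains ?C (Suc m))" and h: "cmap X Y h" for K m h
  proof -
    obtain c where c: "c \<in> carrier (?QX (Suc m))" "K = ?DX (Suc m) #>\<^bsub>?QX (Suc m)\<^esub> c"
      using carrierE[OF K] by blast
    then show ?thesis
      using h hom_in_carrier[OF hom_push_forward_cube[OF h]]
      by (simp add: coset_F coset_b closed cube_boundary_push_forward del: cube.simps)
  qed
  have group_chains: "group (chains (cubical_complex J T Z) m)" for Z :: "'z cspace" and m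
    using normal.factorgroup_is_group[OF normal_degenerate_chains] by (simp add: cubical_complex_def)
  have hom_bdry: "bdry (cubical_complex J T Z) (Suc m) \<in>
      hom (chains (cubical_complex J T Z) (Suc m)) (chains (cubical_complex J T Z) m)" for Z :: "'z cspace" and m
    using hom_quot[OF hom_cube_boundary cube_boundary_degenerate] by (simp add: cubical_complex_def)
  have hom_F: "?F h m \<in> hom (chains ?C m) (chains ?D m)" if "cmap X Y h" for h m
    using hom_quot[OF hom_push_forward_cube push_forward_degenerate, OF that that]
    by (simp add: cubical_complex_def)
  have hom_P: "?P m \<in> hom (chains ?C m) (chains ?D (Suc m))" for m
    using hom_quot[OF hom_cube_prism_chain cube_prism_chain_degenerate, OF X H(1) X H(1)]
    by (simp add: cubical_complex_def)
  show ?thesis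
    unfolding cubical_pullback_def
  proof (rule cohomology_map_eq_if_chain_homotopic[where P = ?P])
    fix K assume "K \<in> carrier (chains ?C 0)"
    then obtain c where c: "c \<in> carrier (?QX 0)" "K = ?DX 0 #>\<^bsub>?QX 0\<^esub> c"
      using carrierE by blast
    then show "?F g 0 K = bdry ?D (Suc 0) (?P 0 K) \<otimes>\<^bsub>chains ?D 0\<^esub> ?F f 0 K"
      using cube_prism_chain_homotopy[OF H(2) c(1)]
      by (simp add: coset_F coset_P coset_b f g closed mult del: cube.simps)
  next
    fix m K assume "K \<in> carrier (chains ?C (Suc m))"
    then obtain c where c: "c \<in> carrier (?QX (Suc m))" "K = ?DX (Suc m) #>\<^bsub>?QX (Suc m)\<^esub> c"
      using carrierE by blast
    then show "?F g (Suc m) K = ?P m (bdry ?C (Suc m) K) \<otimes>\<^bsub>chains ?D (Suc m)\<^esub>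
        (bdry ?D (Suc (Suc m)) (?P (Suc m) K) \<otimes>\<^bsub>chains ?D (Suc m)\<^esub> ?F f (Suc m) K)"
      using cube_prism_chain_homotopy[OF H(2) c(1)]
      by (simp add: coset_F coset_P coset_b f g closed mult add del: cube.simps)
  qed (assumption | rule G group_chains hom_bdry hom_F hom_P f g chain)+
qed

section \<open>Homotopy invariance\<close>

theorem theorem6p7:
  fixes J :: interval_kind and T :: product_kind
    and X :: "'a cspace" and Y :: "'b cspace" and f g :: "'a \<Rightarrow> 'b"
    and G :: "('g, 'm) monoid_scheme"
  assumes "comm_group G"
    and "closure_space X" and "closure_space Y"
    and "cmap X Y f" and "cmap X Y g"
  shows "(homotopic_JT J T X Y f g \<longrightarrow>
            (\<forall>n. cubical_pullback J T X Y G n f = cubical_pullback J T X Y G n g)) \<and>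
         (homotopic_JT J Product X Y f g \<longrightarrow>
            (case J of
               Interval_I \<Rightarrow> \<forall>n.
                 simplicial_pullback simplex_I simplical_face X Y G n f =
                 simplicial_pullback simplex_I simplical_face X Y G n g
             | Interval_J1 \<Rightarrow> \<forall>n.
                 simplicial_pullback simplex_J1 vertex_face X Y G n f =
                 simplicial_pullback simplex_J1 vertex_face X Y G n g
             | Interval_Jplus \<Rightarrow> \<forall>n.
                 simplicial_pullback simplex_Jplus vertex_face X Y G n f =
                 simplicial_pullback simplex_Jplus vertex_face X Y G n g))"
proof -
  \<comment> \<open>Here h is any of the pullbacks as a function of the map. Equality of its values
    is reflexive, symmetric and transitive, so it extends from single steps to the generated
    equivalence.\<close>
  have eq: "h f = h g"
    if "homotopic_JT J T' X Y f g" and "\<And>f g. one_step_homotopic J T' X Y f g \<Longrightarrow> h f = h g"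
    for T' and h :: "('a \<Rightarrow> 'b) \<Rightarrow> 'z"
    using that(1) unfolding homotopic_JT_def
    by (induction rule: equivclp_induct) (auto dest: that(2))
  note simplicial = simplicial_model.simplicial_pullback_eq[OF _ assms(1,2)]
  show ?thesis
    by (auto split: interval_kind.split intro: eq cubical_pullback_eq[OF assms(1,2)]
        simplicial[OF simplicial_model_I] simplicial[OF simplicial_model_J1]
        simplicial[OF simplicial_model_Jplus])
qed

end
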